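(* Consider the implicitly constrained least-squares problem $\min_{u\in\mathbb{R}^n}\hat J(u)$, $\hat J(u)=\frac12\|\hat R(u)\|^2$, and the regularization method described in the context, with every subproblem solved exactly, i.e. $s_k$ is the exact minimizer of $s\mapsto m_k(u_k+s)$ for every $k$. Assume that: (1) $\hat J$ is continuously differentiable and $\nabla\hat J$ is $L$-Lipschitz continuous for some $L>0$; (2) there is $M_H>0$ such that $\|H_k\|\le M_H$ for all $k$; (3) $H_k$ is positive semidefinite for all $k$; (4) for every $u\in\mathbb{R}^n$ there exists a unique $y(u)\in\mathbb{R}^{n_y}$ with $c(y(u),u)=0$, the functions $J$ and $c$ are twice continuously differentiable, and the Jacobian $c_y$ of $c$ with respect to its first argument is invertible at any $(y,u)$ such that $c(y,u)=0$; (5) Jacobian evaluations $\hat G(u)$ are performed by solving the adjoint equation $c_y(y(u),u)\,\zeta(u)=-c_u(y(u),u)$ for $\zeta(u)$ and setting $\hat G(u)=G_u(y(u),u)+G_y(y(u),u)\zeta(u)$. For $\epsilon_g\in(0,1)$ and $\epsilon_R>0$, let $\mathcal{S}_{\epsilon_g,\epsilon_R}$ (resp. $\mathcal{U}_{\epsilon_g,\epsilon_R}$) be the set of successful (resp. unsuccessful) iterations $k$ for which $u_k$ does not satisfy $$\|\hat R(u_k)\|\le\epsilon_R\quad\text{or}\quad \frac{\|\hat G(u_k)^{\mathrm T}\hat R(u_k)\|}{\|\hat R(u_k)\|}\le\epsilon_g. \qquad ( * )$$ Then, counting the initial computations and those made in the iterations at which $( * )$ does not hold, the number of solves of the implicit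 constraint for $y$ is $$1+|\mathcal{S}_{\epsilon_g,\epsilon_R}|+|\mathcal{U}_{\epsilon_g,\epsilon_R}|=\mathcal{O}\left(\log(\epsilon_R^{-1})\,\epsilon_g^{-2}\right),$$ while the number of adjoint solves is $$1+|\mathcal{S}_{\epsilon_g,\epsilon_R}|=\mathcal{O}\left(\log(\epsilon_R^{-1})\,\epsilon_g^{-2}\right).$$ Here $\mathcal{O}$ means: there exist constants $C>0$ and $\bar\epsilon\in(0,1)$, depending only on $L$, $M_H$, $\eta$, $\gamma_0$, $\gamma_{\min}$ and $\hat J(u_0)$, such that each quantity is at most $C\log(\epsilon_R^{-1})\epsilon_g^{-2}$ for all $\epsilon_g\in(0,1)$ and $\epsilon_R\in(0,\bar\epsilon]$.
   Context: Setting. $\|\cdot\|$ is the Euclidean norm for vectors and the spectral norm for matrices. $R:\mathbb{R}^{n_y}\times\mathbb{R}^n\to\mathbb{R}^m$ and $c:\mathbb{R}^{n_y}\times\mathbb{R}^n\to\mathbb{R}^p$ are given, $J(y,u)=\frac12\|R(y,u)\|^2$; $G_y,G_u$ denote the Jacobians of $R$, and $c_y,c_u$ those of $c$, with respect to the first and second arguments. For each $u$, $y(u)$ is the unique solution of $c(y,u)=0$. Put $\hat R(u)=R(y(u),u)$, $\hat J(u)=J(y(u),u)=\frac12\|\hat R(u)\|^2$, and let $\hat G(u)$ be the Jacobian of $\hat R$ at $u$, so that $\nabla\hat J(u)=\hat G(u)^{\mathrm T}\hat R(u)$. Method. Inputs: $u_0\in\mathbb{R}^n$, $\gamma_0>0$,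 $0<\gamma_{\min}\le\gamma_0$, $\eta\in(0,1)$. Solve $c(y,u_0)=0$ for $y(u_0)$ and compute $R_0=\hat R(u_0)$, $G_0=\hat G(u_0)$. For $k=0,1,2,\dots$, with $R_k=\hat R(u_k)$, $G_k=\hat G(u_k)$, $g_k=G_k^{\mathrm T}R_k=\nabla\hat J(u_k)$ and $H_k\in\mathbb{R}^{n\times n}$ a symmetric matrix: compute a step $s_k$ by (approximately) minimizing over $s\in\mathbb{R}^n$ the model $$m_k(u_k+s)=\tfrac12\|R_k\|^2+g_k^{\mathrm T}s+\tfrac12 s^{\mathrm T}(H_k+\gamma_kI)s;$$ solve $c(y,u_k+s_k)=0$ for $y(u_k+s_k)$ and compute $\rho_k=\dfrac{\hat J(u_k)-\hat J(u_k+s_k)}{m_k(u_k)-m_k(u_k+s_k)}$. If $\rho_k\ge\eta$, set $u_{k+1}=u_k+s_k$, $\gamma_{k+1}=\max\{0.5\gamma_k,\gamma_{\min}\}$ and evaluate $R_{k+1}$ and $G_{k+1}$ (the already computed $y(u_{k+1})=y(u_k+s_k)$ is reused and counts as one solve); otherwise set $u_{k+1}=u_k$, $\gamma_{k+1}=2\gamma_k$. (If $g_k=0$, then $s_k=0$, the ratio is $0/0$, and $u_{k+1}=u_k$ regardless.) Iteration $k$ is successful if $u_{k+1}\ne u_k$ and unsuccessful otherwise. Each evaluation of $\hat G$ uses one adjoint solve. When $\hat R(u_k)=0$ the first alternative of $( * )$ holds, so the quotient is only considered for $\hat R(u_k)\neq0$. *)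

theory Defs
  imports Complex_Main "Jordan_Normal_Form.Matrix"
begin

text \<open>
  The constants hidden in the complexity bounds must not depend on the dimensions, so the
  dimensions are natural numbers that can be quantified inside a formula, and $\mathbb{R}^d$ is
  \<open>carrier_vec d :: real vec set\<close>.  That type has no normed space structure, hence the
  elementary differential calculus below; all notions are relative to the carriers.
\<close>

definition euclid_norm :: "real vec \<Rightarrow> real" where
  "euclid_norm v = sqrt (v \<bullet> v)"

definition spectral_norm :: "real mat \<Rightarrow> real" where
  "spectral_norm A =
     Sup {euclid_norm (A *\<^sub>v x) | x. x \<in> carrier_vec (dim_col A) \<and> euclid_norm x \<le> 1}"

definition positive_semidefinite_mat :: "nat \<Rightarrow> real mat \<Rightarrow> bool" where
  "positive_semidefinite_mat d A \<longleftrightarrow> (\<forall>x\<in>carrier_vec d. 0 \<le> x \<bullet> (A *\<^sub>v x))"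

definition has_vec_jacobian ::
  "nat \<Rightarrow> nat \<Rightarrow> (real vec \<Rightarrow> real vec) \<Rightarrow> real vec \<Rightarrow> real mat \<Rightarrow> bool" where
  "has_vec_jacobian d q f x A \<longleftrightarrow>
     A \<in> carrier_mat q d \<and>
     (\<forall>e>0. \<exists>r>0. \<forall>h\<in>carrier_vec d. euclid_norm h < r \<longrightarrow>
        euclid_norm (f (x + h) - f x - A *\<^sub>v h) \<le> e * euclid_norm h)"

definition vec_differentiable ::
  "nat \<Rightarrow> nat \<Rightarrow> (real vec \<Rightarrow> real vec) \<Rightarrow> bool" where
  "vec_differentiable d q f \<longleftrightarrow> (\<forall>x\<in>carrier_vec d. \<exists>A. has_vec_jacobian d q f x A)"

definition vec_jacobian ::
  "nat \<Rightarrow> nat \<Rightarrow> (real vec \<Rightarrow> real vec) \<Rightarrow> real vec \<Rightarrow> real mat" where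
  "vec_jacobian d q f x = (THE A. has_vec_jacobian d q f x A)"

definition vec_continuous :: "nat \<Rightarrow> (real vec \<Rightarrow> real) \<Rightarrow> bool" where
  "vec_continuous d f \<longleftrightarrow>
     (\<forall>x\<in>carrier_vec d. \<forall>e>0. \<exists>r>0. \<forall>z\<in>carrier_vec d.
        euclid_norm (z - x) < r \<longrightarrow> \<bar>f z - f x\<bar> < e)"

definition vec_C1 :: "nat \<Rightarrow> nat \<Rightarrow> (real vec \<Rightarrow> real vec) \<Rightarrow> bool" where
  "vec_C1 d q f \<longleftrightarrow>
     vec_differentiable d q f \<and>
     (\<forall>i<q. \<forall>j<d. vec_continuous d (\<lambda>x. vec_jacobian d q f x $$ (i, j)))"

text \<open>Real-valued functions are treated as functions into \<open>carrier_vec 1\<close>.\<close>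

definition scalar_vec :: "real \<Rightarrow> real vec" where
  "scalar_vec a = vec 1 (\<lambda>_. a)"

definition vec_C2 :: "nat \<Rightarrow> nat \<Rightarrow> (real vec \<Rightarrow> real vec) \<Rightarrow> bool" where
  "vec_C2 d q f \<longleftrightarrow>
     vec_differentiable d q f \<and>
     (\<forall>i<q. \<forall>j<d. vec_C1 d 1 (\<lambda>x. scalar_vec (vec_jacobian d q f x $$ (i, j))))"

definition vec_gradient :: "nat \<Rightarrow> (real vec \<Rightarrow> real) \<Rightarrow> real vec \<Rightarrow> real vec" where
  "vec_gradient d f x = row (vec_jacobian d 1 (\<lambda>z. scalar_vec (f z)) x) 0"

text \<open>A function of \<open>(y, u)\<close> seen as a function of the concatenated vector \<open>y @\<^sub>v u\<close>.\<close>

definition joint :: "nat \<Rightarrow> nat \<Rightarrow> (real vec \<Rightarrow> real vec \<Rightarrow> 'b) \<Rightarrow> real vec \<Rightarrow> 'b" where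
  "joint d1 d2 f z = f (vec_first z d1) (vec_last z d2)"

record ls_problem =
  dim_state :: nat
  dim_ctrl :: nat
  dim_resid :: nat
  dim_constr :: nat
  resid :: "real vec \<Rightarrow> real vec \<Rightarrow> real vec"
  constr :: "real vec \<Rightarrow> real vec \<Rightarrow> real vec"

text \<open>Differentiability of the residual is the standing assumption under which its Jacobians
  exist.\<close>

definition ls_setting :: "ls_problem \<Rightarrow> bool" where
  "ls_setting P \<longleftrightarrow>
     (\<forall>y\<in>carrier_vec (dim_state P). \<forall>u\<in>carrier_vec (dim_ctrl P).
        resid P y u \<in> carrier_vec (dim_resid P) \<and> constr P y u \<in> carrier_vec (dim_constr P)) \<and>
     vec_differentiable (dim_state P + dim_ctrl P) (dim_resid P)
       (joint (dim_state P) (dim_ctrl P) (resid P))"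

definition ls_obj :: "ls_problem \<Rightarrow> real vec \<Rightarrow> real vec \<Rightarrow> real" where
  "ls_obj P y u = (euclid_norm (resid P y u))\<^sup>2 / 2"

definition resid_jac_state :: "ls_problem \<Rightarrow> real vec \<Rightarrow> real vec \<Rightarrow> real mat" where
  "resid_jac_state P y u = vec_jacobian (dim_state P) (dim_resid P) (\<lambda>y'. resid P y' u) y"

definition resid_jac_ctrl :: "ls_problem \<Rightarrow> real vec \<Rightarrow> real vec \<Rightarrow> real mat" where
  "resid_jac_ctrl P y u = vec_jacobian (dim_ctrl P) (dim_resid P) (\<lambda>u'. resid P y u') u"

definition constr_jac_state :: "ls_problem \<Rightarrow> real vec \<Rightarrow> real vec \<Rightarrow> real mat" where
  "constr_jac_state P y u = vec_jacobian (dim_state P) (dim_constr P) (\<lambda>y'. constr P y' u) y"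

definition constr_jac_ctrl :: "ls_problem \<Rightarrow> real vec \<Rightarrow> real vec \<Rightarrow> real mat" where
  "constr_jac_ctrl P y u = vec_jacobian (dim_ctrl P) (dim_constr P) (\<lambda>u'. constr P y u') u"

definition solves_constr :: "ls_problem \<Rightarrow> real vec \<Rightarrow> real vec \<Rightarrow> bool" where
  "solves_constr P y u \<longleftrightarrow>
     y \<in> carrier_vec (dim_state P) \<and> constr P y u = 0\<^sub>v (dim_constr P)"

definition state :: "ls_problem \<Rightarrow> real vec \<Rightarrow> real vec" where
  "state P u = (THE y. solves_constr P y u)"

definition Rhat :: "ls_problem \<Rightarrow> real vec \<Rightarrow> real vec" where
  "Rhat P u = resid P (state P u) u"

definition Jhat :: "ls_problem \<Rightarrow> real vec \<Rightarrow> real" where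
  "Jhat P u = ls_obj P (state P u) u"

definition Ghat :: "ls_problem \<Rightarrow> real vec \<Rightarrow> real mat" where
  "Ghat P u = vec_jacobian (dim_ctrl P) (dim_resid P) (Rhat P) u"

definition lipschitz_gradient :: "ls_problem \<Rightarrow> real \<Rightarrow> bool" where
  "lipschitz_gradient P L \<longleftrightarrow>
     vec_C1 (dim_ctrl P) 1 (\<lambda>u. scalar_vec (Jhat P u)) \<and>
     (\<forall>u\<in>carrier_vec (dim_ctrl P). \<forall>v\<in>carrier_vec (dim_ctrl P).
        euclid_norm (vec_gradient (dim_ctrl P) (Jhat P) u - vec_gradient (dim_ctrl P) (Jhat P) v)
          \<le> L * euclid_norm (u - v))"

definition regular_constraint :: "ls_problem \<Rightarrow> bool" where
  "regular_constraint P \<longleftrightarrow>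
     (\<forall>u\<in>carrier_vec (dim_ctrl P). \<exists>!y. solves_constr P y u) \<and>
     vec_C2 (dim_state P + dim_ctrl P) 1
       (\<lambda>z. scalar_vec (joint (dim_state P) (dim_ctrl P) (ls_obj P) z)) \<and>
     vec_C2 (dim_state P + dim_ctrl P) (dim_constr P)
       (joint (dim_state P) (dim_ctrl P) (constr P)) \<and>
     (\<forall>u\<in>carrier_vec (dim_ctrl P). \<forall>y. solves_constr P y u \<longrightarrow>
        invertible_mat (constr_jac_state P y u))"

definition adjoint_evaluation :: "ls_problem \<Rightarrow> (real vec \<Rightarrow> real mat) \<Rightarrow> bool" where
  "adjoint_evaluation P zeta \<longleftrightarrow>
     (\<forall>u\<in>carrier_vec (dim_ctrl P).
        zeta u \<in> carrier_mat (dim_state P) (dim_ctrl P) \<and>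
        constr_jac_state P (state P u) u * zeta u = - constr_jac_ctrl P (state P u) u \<and>
        Ghat P u =
          resid_jac_ctrl P (state P u) u + resid_jac_state P (state P u) u * zeta u)"

record method_data =
  ctrl :: "nat \<Rightarrow> real vec"
  step :: "nat \<Rightarrow> real vec"
  reg :: "nat \<Rightarrow> real"
  hess :: "nat \<Rightarrow> real mat"

definition grad :: "ls_problem \<Rightarrow> method_data \<Rightarrow> nat \<Rightarrow> real vec" where
  "grad P r k = transpose_mat (Ghat P (ctrl r k)) *\<^sub>v Rhat P (ctrl r k)"

text \<open>\<open>model P r k s\<close> is the value $m_k(u_k + s)$.\<close>

definition model :: "ls_problem \<Rightarrow> method_data \<Rightarrow> nat \<Rightarrow> real vec \<Rightarrow> real" where
  "model P r k s =
     (euclid_norm (Rhat P (ctrl r k)))\<^sup>2 / 2 + grad P r k \<bullet> s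
     + (s \<bullet> ((hess r k + reg r k \<cdot>\<^sub>m 1\<^sub>m (dim_ctrl P)) *\<^sub>v s)) / 2"

definition ratio :: "ls_problem \<Rightarrow> method_data \<Rightarrow> nat \<Rightarrow> real" where
  "ratio P r k =
     (Jhat P (ctrl r k) - Jhat P (ctrl r k + step r k)) /
     (model P r k (0\<^sub>v (dim_ctrl P)) - model P r k (step r k))"

text \<open>At a stationary iterate the ratio is \<open>0/0\<close>: the control is kept, and either update of the
  regularization parameter is allowed.\<close>

definition method_run :: "ls_problem \<Rightarrow> real \<Rightarrow> real \<Rightarrow> real \<Rightarrow> method_data \<Rightarrow> bool" where
  "method_run P eta gamma0 gamma_min r \<longleftrightarrow>
     ctrl r 0 \<in> carrier_vec (dim_ctrl P) \<and> reg r 0 = gamma0 \<and>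
     (\<forall>k. hess r k \<in> carrier_mat (dim_ctrl P) (dim_ctrl P) \<and>
          transpose_mat (hess r k) = hess r k \<and>
          step r k \<in> carrier_vec (dim_ctrl P) \<and>
          (if grad P r k = 0\<^sub>v (dim_ctrl P)
           then ctrl r (Suc k) = ctrl r k \<and>
                reg r (Suc k) \<in> {max (reg r k / 2) gamma_min, 2 * reg r k}
           else if eta \<le> ratio P r k
           then ctrl r (Suc k) = ctrl r k + step r k \<and>
                reg r (Suc k) = max (reg r k / 2) gamma_min
           else ctrl r (Suc k) = ctrl r k \<and> reg r (Suc k) = 2 * reg r k))"

definition exact_steps :: "ls_problem \<Rightarrow> method_data \<Rightarrow> bool" where
  "exact_steps P r \<longleftrightarrow>
     (\<forall>k. step r k \<in> carrier_vec (dim_ctrl P) \<and>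
          (\<forall>s\<in>carrier_vec (dim_ctrl P). model P r k (step r k) \<le> model P r k s))"

definition successful :: "method_data \<Rightarrow> nat \<Rightarrow> bool" where
  "successful r k \<longleftrightarrow> ctrl r (Suc k) \<noteq> ctrl r k"

definition approx_optimal :: "ls_problem \<Rightarrow> real \<Rightarrow> real \<Rightarrow> real vec \<Rightarrow> bool" where
  "approx_optimal P eps_g eps_R u \<longleftrightarrow>
     euclid_norm (Rhat P u) \<le> eps_R \<or>
     euclid_norm (transpose_mat (Ghat P u) *\<^sub>v Rhat P u) / euclid_norm (Rhat P u) \<le> eps_g"

definition counted_iters :: "ls_problem \<Rightarrow> method_data \<Rightarrow> real \<Rightarrow> real \<Rightarrow> nat set" where
  "counted_iters P r eps_g eps_R = {k. \<not> approx_optimal P eps_g eps_R (ctrl r k)}"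

definition succ_iters :: "ls_problem \<Rightarrow> method_data \<Rightarrow> real \<Rightarrow> real \<Rightarrow> nat set" where
  "succ_iters P r eps_g eps_R = {k \<in> counted_iters P r eps_g eps_R. successful r k}"

definition unsucc_iters :: "ls_problem \<Rightarrow> method_data \<Rightarrow> real \<Rightarrow> real \<Rightarrow> nat set" where
  "unsucc_iters P r eps_g eps_R = {k \<in> counted_iters P r eps_g eps_R. \<not> successful r k}"

text \<open>The linear and nonlinear systems solved by the method, tagged with the control at which they
  are solved.\<close>

datatype system_solve =
    is_constraint_solve: Constraint_Solve "real vec"
  | is_adjoint_solve: Adjoint_Solve "real vec"

definition initial_solves :: "method_data \<Rightarrow> system_solve list" where
  "initial_solves r = [Constraint_Solve (ctrl r 0), Adjoint_Solve (ctrl r 0)]"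

text \<open>Only an accepted trial point requires a new Jacobian; its state is already available.\<close>

definition iteration_solves ::
  "ls_problem \<Rightarrow> real \<Rightarrow> method_data \<Rightarrow> nat \<Rightarrow> system_solve list" where
  "iteration_solves P eta r k =
     Constraint_Solve (ctrl r k + step r k) #
     (if eta \<le> ratio P r k then [Adjoint_Solve (ctrl r (Suc k))] else [])"

definition num_solves ::
  "(system_solve \<Rightarrow> bool) \<Rightarrow> ls_problem \<Rightarrow> real \<Rightarrow> method_data \<Rightarrow> real \<Rightarrow> real \<Rightarrow> nat" where
  "num_solves kind P eta r eps_g eps_R =
     length (filter kind (initial_solves r)) +
     (\<Sum>k\<in>counted_iters P r eps_g eps_R. length (filter kind (iteration_solves P eta r k)))"

end

theory Submission
  imports Defs "HOL-Analysis.L2_Norm"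
begin

text \<open>
  The proof joins a fact from calculus to a counting argument.

  The method follows the gradient of the reduced objective: the vector
  $g_k = \hat G(u_k)^T \hat R(u_k)$ is $\nabla \hat J(u_k)$ as soon as $\hat R$ is differentiable, and this in turn needs
  the state $y(u)$ to be differentiable in $u$.  Nothing is assumed about the regularity of
  $u \mapsto y(u)$, not even continuity: it comes from the implicit function theorem.  With $B$ the
  inverse of $c_y$ at $(y(u_0), u_0)$, the map $y \mapsto y - B\,c(y, u)$ is a contraction near
  $y(u_0)$, because $c$ is $C^1$ and therefore strictly differentiable; its fixed point solves
  $c(y, u) = 0$, so by the global uniqueness of solutions it is $y(u)$.  The contraction also
  bounds $\|y(u) - y(u_0)\|$ by a multiple of $\|u - u_0\|$, which turns the linearisation of $c$ into
  a derivative of $y$ (\<open>implicit_function_differentiable\<close>, \<open>vec_gradient_Jhat\<close>).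

  For the count, an exact minimizer does at least as well as the best step along $-g_k$, hence the
  model decrease is at least $\|g_k\|^2 / (2 (M_H + \gamma_k))$.  If $\gamma_k \ge L$, the descent lemma
  and $H_k \succeq 0$ show that the actual decrease is at least the predicted one, so the step is
  accepted.  Hence $\gamma_k \le \max(\gamma_0, 2L) =: \Gamma$ at every nonstationary iterate, and an
  accepted step taken where $(*)$ fails satisfies
  \[ \hat J(u_{k+1}) \le \hat J(u_k) - \frac{\eta \|g_k\|^2}{2 (M_H + \Gamma)}
     \le \Bigl(1 - \frac{\eta\,\epsilon_g^2}{M_H + \Gamma}\Bigr) \hat J(u_k), \]
  since $\|g_k\| > \epsilon_g \|\hat R(u_k)\|$ there.  This is where the logarithm comes from: $\hat J$
  shrinks geometrically while it stays above $\epsilon_R^2 / 2$, which allows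
  $O(\log(\epsilon_R^{-1})\,\epsilon_g^{-2})$ such steps (\<open>geometric_decrease_card_le\<close>).

  An unsuccessful iteration at a nonstationary control keeps the control and doubles $\gamma$.  As
  $\gamma \ge \gamma_{\min}$ always, at most $K$ such iterations, with $2^K \gamma_{\min} \ge L$, can
  follow one another before a success at the same control.  Every counted iteration is thus at
  distance at most $K$ from a counted successful one (\<open>success_within\<close>), and the total is at most
  $K + 1$ times the number of successes.  This local argument is insensitive to iterations that
  are left out of the count because $(*)$ holds there, possibly between counted ones.
\<close>

section \<open>Euclidean norm, concatenation and matrix-vector products\<close>

lemma euclid_norm_eq_L2_set: "euclid_norm v = L2_set (($) v) {0..<dim_vec v}"
  by (simp add: euclid_norm_def L2_set_def scalar_prod_def power2_eq_square)

lemma euclid_norm_nonneg [simp]: "0 \<le> euclid_norm v"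
  by (simp add: euclid_norm_eq_L2_set)

lemma euclid_norm_squared: "(euclid_norm v)\<^sup>2 = v \<bullet> v"
  by (simp add: euclid_norm_def scalar_prod_def sum_nonneg)

lemma euclid_norm_zero [simp]: "euclid_norm (0\<^sub>v d) = 0"
  by (simp add: euclid_norm_def)

lemma euclid_norm_eq_0_iff: "v \<in> carrier_vec d \<Longrightarrow> euclid_norm v = 0 \<longleftrightarrow> v = 0\<^sub>v d"
  by (auto simp: euclid_norm_eq_L2_set L2_set_eq_0_iff intro!: eq_vecI)

lemma euclid_norm_add_le:
  assumes "dim_vec v = dim_vec w"
  shows "euclid_norm (v + w) \<le> euclid_norm v + euclid_norm w"
proof -
  have "euclid_norm (v + w) = L2_set (\<lambda>i. v $ i + w $ i) {0..<dim_vec w}"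
    unfolding euclid_norm_eq_L2_set by (auto intro: L2_set_cong)
  then show ?thesis
    using L2_set_triangle_ineq assms by (simp add: euclid_norm_eq_L2_set)
qed

lemma euclid_norm_smult: "euclid_norm (a \<cdot>\<^sub>v v) = \<bar>a\<bar> * euclid_norm v"
proof -
  have "(a \<cdot>\<^sub>v v) \<bullet> (a \<cdot>\<^sub>v v) = a\<^sup>2 * (v \<bullet> v)"
    by (simp add: power2_eq_square)
  then show ?thesis
    by (simp add: euclid_norm_def real_sqrt_mult)
qed

lemma euclid_norm_uminus: "euclid_norm (- v) = euclid_norm v"
  by (simp add: euclid_norm_def)

lemma euclid_norm_minus_commute:
  assumes "dim_vec v = dim_vec w"
  shows "euclid_norm (v - w) = euclid_norm (w - v)"
proof -
  have "v - w = - (w - v)"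
    using assms by (intro eq_vecI) auto
  then show ?thesis
    by (simp add: euclid_norm_uminus)
qed

lemma euclid_norm_diff_triangle:
  assumes "dim_vec u = dim_vec v" "dim_vec v = dim_vec w"
  shows "euclid_norm (u - w) \<le> euclid_norm (u - v) + euclid_norm (v - w)"
proof -
  have "u - w = (u - v) + (v - w)"
    using assms by (intro eq_vecI) auto
  then show ?thesis
    using euclid_norm_add_le[of "u - v" "v - w"] assms by simp
qed

lemma abs_scalar_prod_le:
  assumes "dim_vec v = dim_vec w"
  shows "\<bar>v \<bullet> w\<bar> \<le> euclid_norm v * euclid_norm w"
proof -
  have "\<bar>v \<bullet> w\<bar> \<le> (\<Sum>i = 0..<dim_vec w. \<bar>v $ i\<bar> * \<bar>w $ i\<bar>)"
    unfolding scalar_prod_def abs_mult[symmetric] by (rule sum_abs)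
  also have "\<dots> \<le> euclid_norm v * euclid_norm w"
    using L2_set_mult_ineq assms by (simp add: euclid_norm_eq_L2_set)
  finally show ?thesis .
qed

lemma abs_index_le_euclid_norm:
  assumes "i < dim_vec v"
  shows "\<bar>v $ i\<bar> \<le> euclid_norm v"
proof -
  have "v $ i * v $ i \<le> v \<bullet> v"
    unfolding scalar_prod_def using assms by (intro member_le_sum) auto
  then show ?thesis
    unfolding euclid_norm_def by (intro real_le_rsqrt) (simp add: power2_eq_square)
qed

lemma euclid_norm_le_sum_abs: "euclid_norm v \<le> (\<Sum>i<dim_vec v. \<bar>v $ i\<bar>)"
  using L2_set_le_sum_abs[of "($) v" "{0..<dim_vec v}"]
  by (simp add: euclid_norm_eq_L2_set atLeast0LessThan)

lemma append_vec_eq_add: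
  assumes "v \<in> carrier_vec n" "w \<in> carrier_vec m"
  shows "v @\<^sub>v w = (v @\<^sub>v 0\<^sub>v m) + (0\<^sub>v n @\<^sub>v (w :: real vec))"
  using append_vec_add[of v n "0\<^sub>v n" "0\<^sub>v m" m w] assms by simp

lemma append_vec_diff:
  assumes "v \<in> carrier_vec n" "v' \<in> carrier_vec n" "w \<in> carrier_vec m" "w' \<in> carrier_vec m"
  shows "(v @\<^sub>v w) - (v' @\<^sub>v w') = (v - v') @\<^sub>v (w - (w' :: real vec))"
  using assms by (intro eq_vecI) auto

lemma euclid_norm_append_squared:
  "(euclid_norm (v @\<^sub>v w))\<^sup>2 = (euclid_norm v)\<^sup>2 + (euclid_norm w)\<^sup>2"
  unfolding euclid_norm_squared by (rule scalar_prod_append) (rule carrier_vec_dim_vec)+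

lemma euclid_norm_append_le: "euclid_norm (v @\<^sub>v w) \<le> euclid_norm v + euclid_norm w"
  by (rule power2_le_imp_le) (simp_all add: euclid_norm_append_squared power2_sum)

lemma euclid_norm_append_zero_right: "euclid_norm (v @\<^sub>v 0\<^sub>v d) = euclid_norm v"
  by (rule power2_eq_imp_eq) (simp_all add: euclid_norm_append_squared)

lemma zero_mult_mat_vec: "h \<in> carrier_vec d \<Longrightarrow> 0\<^sub>m q d *\<^sub>v h = (0\<^sub>v q :: real vec)"
  by (intro eq_vecI) auto

lemma mult_mat_vec_cong_imp_eq:
  assumes A: "A \<in> carrier_mat q d" and B: "B \<in> carrier_mat q d"
    and eq: "\<And>h. h \<in> carrier_vec d \<Longrightarrow> A *\<^sub>v h = B *\<^sub>v (h :: real vec)"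
  shows "A = B"
proof (rule eq_matI)
  fix i j assume ij: "i < dim_row B" "j < dim_col B"
  have "(A *\<^sub>v unit_vec d j) $ i = (B *\<^sub>v unit_vec d j) $ i"
    using eq by simp
  then show "A $$ (i, j) = B $$ (i, j)"
    using A B ij by simp
qed (use A B in auto)

text \<open>
The entrywise bound is used because continuity of a Jacobian is given entry by entry.
\<close>

lemma euclid_norm_mult_mat_vec_le:
  assumes "A \<in> carrier_mat q d" "x \<in> carrier_vec d"
  shows "euclid_norm (A *\<^sub>v x) \<le> (\<Sum>i<q. \<Sum>j<d. \<bar>A $$ (i, j)\<bar>) * euclid_norm x"
proof -
  have "\<bar>(A *\<^sub>v x) $ i\<bar> \<le> (\<Sum>j<d. \<bar>A $$ (i, j)\<bar>) * euclid_norm x" if "i < q" for i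
  proof -
    have "\<bar>(A *\<^sub>v x) $ i\<bar> = \<bar>\<Sum>j<d. A $$ (i, j) * x $ j\<bar>"
      using assms that by (simp add: scalar_prod_def atLeast0LessThan)
    also have "\<dots> \<le> (\<Sum>j<d. \<bar>A $$ (i, j)\<bar> * \<bar>x $ j\<bar>)"
      unfolding abs_mult[symmetric] by (rule sum_abs)
    also have "\<dots> \<le> (\<Sum>j<d. \<bar>A $$ (i, j)\<bar> * euclid_norm x)"
      using assms by (intro sum_mono mult_left_mono abs_index_le_euclid_norm) auto
    finally show ?thesis
      by (simp add: sum_distrib_right)
  qed
  then have "(\<Sum>i<q. \<bar>(A *\<^sub>v x) $ i\<bar>) \<le> (\<Sum>i<q. \<Sum>j<d. \<bar>A $$ (i, j)\<bar>) * euclid_norm x"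
    unfolding sum_distrib_right[of _ "{..<q}"] by (intro sum_mono) auto
  moreover have "euclid_norm (A *\<^sub>v x) \<le> (\<Sum>i<q. \<bar>(A *\<^sub>v x) $ i\<bar>)"
    using euclid_norm_le_sum_abs[of "A *\<^sub>v x"] assms by simp
  ultimately show ?thesis
    by linarith
qed

lemma mult_mat_vec_bounded:
  assumes "A \<in> carrier_mat q d"
  obtains K where "K > 0" "\<And>x. x \<in> carrier_vec d \<Longrightarrow> euclid_norm (A *\<^sub>v x) \<le> K * euclid_norm x"
proof
  let ?S = "\<Sum>i<q. \<Sum>j<d. \<bar>A $$ (i, j)\<bar>"
  show "?S + 1 > 0"
    by (simp add: add_nonneg_pos sum_nonneg)
  show "euclid_norm (A *\<^sub>v x) \<le> (?S + 1) * euclid_norm x" if "x \<in> carrier_vec d" for x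
    using euclid_norm_mult_mat_vec_le[OF assms that] euclid_norm_nonneg[of x]
    unfolding distrib_right by linarith
qed

text \<open>
The supremum that defines the spectral norm is over a set that is bounded above, by the entrywise
  bound, so it is an upper bound of this set; the general case follows by scaling.
\<close>

lemma euclid_norm_mult_mat_vec_le_spectral_norm:
  assumes A: "A \<in> carrier_mat q d" and x: "x \<in> carrier_vec d"
  shows "euclid_norm (A *\<^sub>v x) \<le> spectral_norm A * euclid_norm x"
proof (cases "euclid_norm x = 0")
  case True
  then show ?thesis
    using euclid_norm_mult_mat_vec_le[OF A x] by simp
next
  case False
  let ?n = "euclid_norm x"
  let ?V = "{euclid_norm (A *\<^sub>v x) | x. x \<in> carrier_vec (dim_col A) \<and> euclid_norm x \<le> 1}"
  have pos: "?n > 0"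
    using False euclid_norm_nonneg[of x] by linarith
  obtain K where K: "K > 0" "\<And>x. x \<in> carrier_vec d \<Longrightarrow> euclid_norm (A *\<^sub>v x) \<le> K * euclid_norm x"
    using mult_mat_vec_bounded[OF A] by blast
  have bdd: "bdd_above ?V"
  proof (rule bdd_aboveI)
    fix t assume "t \<in> ?V"
    then obtain z where z: "t = euclid_norm (A *\<^sub>v z)" "z \<in> carrier_vec d" "euclid_norm z \<le> 1"
      using A by auto
    have "K * euclid_norm z \<le> K * 1"
      using K(1) z(3) by (intro mult_left_mono) auto
    then show "t \<le> K"
      using K(2)[OF z(2)] z(1) by simp
  qed
  have "euclid_norm (A *\<^sub>v ((1 / ?n) \<cdot>\<^sub>v x)) \<in> ?V"
    using A x pos by (auto simp: euclid_norm_smult intro!: exI[of _ "(1 / ?n) \<cdot>\<^sub>v x"])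
  then have "euclid_norm (A *\<^sub>v ((1 / ?n) \<cdot>\<^sub>v x)) \<le> spectral_norm A"
    unfolding spectral_norm_def using bdd by (rule cSup_upper)
  moreover have "euclid_norm (A *\<^sub>v ((1 / ?n) \<cdot>\<^sub>v x)) = euclid_norm (A *\<^sub>v x) / ?n"
    using mult_mat_vec[OF A x] pos by (simp add: euclid_norm_smult)
  ultimately show ?thesis
    using pos by (simp add: field_simps)
qed

section \<open>Jacobians\<close>

lemma line_point_add: "x \<in> carrier_vec d \<Longrightarrow> h \<in> carrier_vec d \<Longrightarrow>
   x + (t + k) \<cdot>\<^sub>v h = (x + t \<cdot>\<^sub>v h) + k \<cdot>\<^sub>v (h :: real vec)"
  by (intro eq_vecI) (auto simp: algebra_simps)

lemma has_vec_jacobianE: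
  assumes "has_vec_jacobian d q f x A" and "e > 0"
  obtains r where "r > 0" "\<And>v. v \<in> carrier_vec d \<Longrightarrow> euclid_norm v < r \<Longrightarrow>
    euclid_norm (f (x + v) - f x - A *\<^sub>v v) \<le> e * euclid_norm v"
  using assms unfolding has_vec_jacobian_def by blast

text \<open>
Restricting to a line reduces vector calculus to derivatives of real functions of one variable, for
  which the mean value theorem and the uniqueness of derivatives are at hand.
\<close>

lemma has_vec_jacobian_line_index:
  assumes jac: "has_vec_jacobian d q f (x + t \<cdot>\<^sub>v h) A"
    and f: "f \<in> carrier_vec d \<rightarrow> carrier_vec q"
    and x: "x \<in> carrier_vec d" and h: "h \<in> carrier_vec d" and i: "i < q"
  shows "((\<lambda>s. f (x + s \<cdot>\<^sub>v h) $ i) has_real_derivative (A *\<^sub>v h) $ i) (at t)"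
  unfolding DERIV_def
proof (rule LIM_I)
  fix e :: real assume e: "e > 0"
  let ?n = "euclid_norm h + 1" and ?z = "x + t \<cdot>\<^sub>v h"
  have n: "?n > 0"
    using euclid_norm_nonneg[of h] by linarith
  have A: "A \<in> carrier_mat q d"
    using jac by (simp add: has_vec_jacobian_def)
  have "e / ?n > 0"
    using e n by simp
  then obtain r where r: "r > 0" "\<And>v. v \<in> carrier_vec d \<Longrightarrow> euclid_norm v < r \<Longrightarrow>
      euclid_norm (f (?z + v) - f ?z - A *\<^sub>v v) \<le> e / ?n * euclid_norm v"
    using has_vec_jacobianE[OF jac] by blast
  show "\<exists>s>0. \<forall>k. k \<noteq> 0 \<and> norm (k - 0) < s \<longrightarrow>
      norm ((f (x + (t + k) \<cdot>\<^sub>v h) $ i - f (x + t \<cdot>\<^sub>v h) $ i) / k - (A *\<^sub>v h) $ i) < e"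
  proof (intro exI conjI allI impI)
    show "r / ?n > 0"
      using r(1) n by simp
    fix k :: real assume k: "k \<noteq> 0 \<and> norm (k - 0) < r / ?n"
    have "\<bar>k\<bar> * euclid_norm h \<le> \<bar>k\<bar> * ?n"
      by (intro mult_left_mono) auto
    also have "\<dots> < r"
      using k n by (simp add: pos_less_divide_eq)
    finally have "euclid_norm (k \<cdot>\<^sub>v h) < r"
      by (simp add: euclid_norm_smult)
    then have "euclid_norm (f (?z + k \<cdot>\<^sub>v h) - f ?z - A *\<^sub>v (k \<cdot>\<^sub>v h)) \<le> e / ?n * (\<bar>k\<bar> * euclid_norm h)"
      using r(2)[of "k \<cdot>\<^sub>v h"] h by (simp add: euclid_norm_smult)
    moreover have "\<bar>(f (?z + k \<cdot>\<^sub>v h) - f ?z - A *\<^sub>v (k \<cdot>\<^sub>v h)) $ i\<bar>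
        \<le> euclid_norm (f (?z + k \<cdot>\<^sub>v h) - f ?z - A *\<^sub>v (k \<cdot>\<^sub>v h))"
      using A i by (intro abs_index_le_euclid_norm) simp
    moreover have "(f (?z + k \<cdot>\<^sub>v h) - f ?z - A *\<^sub>v (k \<cdot>\<^sub>v h)) $ i
        = f (x + (t + k) \<cdot>\<^sub>v h) $ i - f ?z $ i - k * (A *\<^sub>v h) $ i"
    proof -
      have "f ?z \<in> carrier_vec q"
        using f x h by auto
      then show ?thesis
        unfolding line_point_add[OF x h] mult_mat_vec[OF A h] using A i by simp
    qed
    moreover have "e / ?n * (\<bar>k\<bar> * euclid_norm h) < e * \<bar>k\<bar>"
    proof -
      have "e * \<bar>k\<bar> * euclid_norm h < e * \<bar>k\<bar> * ?n"
        using e k by (intro mult_strict_left_mono) auto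
      then show ?thesis
        using n by (simp add: field_simps)
    qed
    ultimately have "\<bar>f (x + (t + k) \<cdot>\<^sub>v h) $ i - f ?z $ i - k * (A *\<^sub>v h) $ i\<bar> < e * \<bar>k\<bar>"
      by linarith
    moreover have "(f (x + (t + k) \<cdot>\<^sub>v h) $ i - f ?z $ i) / k - (A *\<^sub>v h) $ i
        = (f (x + (t + k) \<cdot>\<^sub>v h) $ i - f ?z $ i - k * (A *\<^sub>v h) $ i) / k"
      using k by (simp add: field_simps)
    ultimately show "norm ((f (x + (t + k) \<cdot>\<^sub>v h) $ i - f ?z $ i) / k - (A *\<^sub>v h) $ i) < e"
      using k by (simp add: abs_divide pos_divide_less_eq)
  qed
qed

text \<open>
This is what makes the description operator in \<^const>\<open>vec_jacobian\<close> meaningful.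
\<close>

lemma has_vec_jacobian_unique:
  assumes A: "has_vec_jacobian d q f x A" and B: "has_vec_jacobian d q f x B"
    and f: "f \<in> carrier_vec d \<rightarrow> carrier_vec q" and x: "x \<in> carrier_vec d"
  shows "A = B"
proof (rule mult_mat_vec_cong_imp_eq)
  show AB: "A \<in> carrier_mat q d" "B \<in> carrier_mat q d"
    using A B by (auto simp: has_vec_jacobian_def)
  fix h :: "real vec" assume h: "h \<in> carrier_vec d"
  have x0: "x + 0 \<cdot>\<^sub>v h = x"
    using x h by (intro eq_vecI) auto
  show "A *\<^sub>v h = B *\<^sub>v h"
  proof (rule eq_vecI)
    fix i assume "i < dim_vec (B *\<^sub>v h)"
    then have i: "i < q"
      using AB by simp
    show "(A *\<^sub>v h) $ i = (B *\<^sub>v h) $ i"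
      by (rule DERIV_unique[OF has_vec_jacobian_line_index[where t = 0] has_vec_jacobian_line_index[where t = 0]])
        (use A B f x h i in \<open>simp_all add: x0\<close>)
  qed (use AB in auto)
qed

lemma vec_jacobian_eq:
  assumes "has_vec_jacobian d q f x A" "f \<in> carrier_vec d \<rightarrow> carrier_vec q" "x \<in> carrier_vec d"
  shows "vec_jacobian d q f x = A"
  unfolding vec_jacobian_def
  using assms has_vec_jacobian_unique by (intro the_equality) blast+

lemma has_vec_jacobian_vec_jacobian:
  assumes "vec_differentiable d q f" "f \<in> carrier_vec d \<rightarrow> carrier_vec q" "x \<in> carrier_vec d"
  shows "has_vec_jacobian d q f x (vec_jacobian d q f x)"
  using assms vec_jacobian_eq unfolding vec_differentiable_def by metis

lemma has_vec_jacobian_cong: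
  assumes "has_vec_jacobian d q f x A" "x \<in> carrier_vec d"
    and "\<And>z. z \<in> carrier_vec d \<Longrightarrow> f z = g z"
  shows "has_vec_jacobian d q g x A"
  using assms by (simp add: has_vec_jacobian_def)

lemma has_vec_jacobian_id:
  assumes x: "x \<in> carrier_vec d"
  shows "has_vec_jacobian d d (\<lambda>x. x) x (1\<^sub>m d)"
proof -
  have "x + h - x - 1\<^sub>m d *\<^sub>v h = 0\<^sub>v d" if "h \<in> carrier_vec d" for h
    using x that by (intro eq_vecI) auto
  then show ?thesis
    by (auto simp: has_vec_jacobian_def intro!: exI[of _ 1])
qed

lemma has_vec_jacobian_const:
  assumes c: "c \<in> carrier_vec q"
  shows "has_vec_jacobian d q (\<lambda>x. c) x (0\<^sub>m q d)"
  using c by (auto simp: has_vec_jacobian_def zero_mult_mat_vec intro!: exI[of _ 1])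

lemma has_vec_jacobian_append:
  assumes f: "f \<in> carrier_vec d \<rightarrow> carrier_vec q" and g: "g \<in> carrier_vec d \<rightarrow> carrier_vec p"
    and x: "x \<in> carrier_vec d"
    and fA: "has_vec_jacobian d q f x A" and gB: "has_vec_jacobian d p g x B"
  shows "has_vec_jacobian d (q + p) (\<lambda>x. f x @\<^sub>v g x) x (A @\<^sub>r B)"
  unfolding has_vec_jacobian_def
proof (intro conjI allI impI)
  have A: "A \<in> carrier_mat q d" and B: "B \<in> carrier_mat p d"
    using fA gB by (auto simp: has_vec_jacobian_def)
  then show "A @\<^sub>r B \<in> carrier_mat (q + p) d"
    by simp
  fix e :: real assume e: "e > 0"
  obtain r1 where r1: "r1 > 0" "\<And>v. v \<in> carrier_vec d \<Longrightarrow> euclid_norm v < r1 \<Longrightarrow>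
      euclid_norm (f (x + v) - f x - A *\<^sub>v v) \<le> e / 2 * euclid_norm v"
    using has_vec_jacobianE[OF fA, of "e / 2"] e by auto
  obtain r2 where r2: "r2 > 0" "\<And>v. v \<in> carrier_vec d \<Longrightarrow> euclid_norm v < r2 \<Longrightarrow>
      euclid_norm (g (x + v) - g x - B *\<^sub>v v) \<le> e / 2 * euclid_norm v"
    using has_vec_jacobianE[OF gB, of "e / 2"] e by auto
  show "\<exists>r>0. \<forall>h\<in>carrier_vec d. euclid_norm h < r \<longrightarrow>
      euclid_norm ((f (x + h) @\<^sub>v g (x + h)) - (f x @\<^sub>v g x) - (A @\<^sub>r B) *\<^sub>v h) \<le> e * euclid_norm h"
  proof (intro exI conjI ballI impI)
    show "min r1 r2 > 0"
      using r1 r2 by simp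
    fix h :: "real vec" assume h: "h \<in> carrier_vec d" and small: "euclid_norm h < min r1 r2"
    have c: "f (x + h) \<in> carrier_vec q" "f x \<in> carrier_vec q" "g (x + h) \<in> carrier_vec p"
        "g x \<in> carrier_vec p" "A *\<^sub>v h \<in> carrier_vec q" "B *\<^sub>v h \<in> carrier_vec p"
      using f g x h A B by auto
    have "(f (x + h) @\<^sub>v g (x + h)) - (f x @\<^sub>v g x) - (A @\<^sub>r B) *\<^sub>v h
        = (f (x + h) - f x - A *\<^sub>v h) @\<^sub>v (g (x + h) - g x - B *\<^sub>v h)"
      unfolding mat_mult_append[OF A B h] append_vec_diff[OF c(1,2) c(3,4)]
      using c by (intro append_vec_diff) auto
    then show "euclid_norm ((f (x + h) @\<^sub>v g (x + h)) - (f x @\<^sub>v g x) - (A @\<^sub>r B) *\<^sub>v h)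
        \<le> e * euclid_norm h"
      using euclid_norm_append_le[of "f (x + h) - f x - A *\<^sub>v h" "g (x + h) - g x - B *\<^sub>v h"]
        r1(2)[OF h] r2(2)[OF h] small by simp
  qed
qed

lemma has_vec_jacobian_lipschitz_at:
  assumes jac: "has_vec_jacobian d q f x A"
    and f: "f \<in> carrier_vec d \<rightarrow> carrier_vec q" and x: "x \<in> carrier_vec d"
  obtains K r where "K > 0" "r > 0"
    "\<And>h. h \<in> carrier_vec d \<Longrightarrow> euclid_norm h < r \<Longrightarrow>
       euclid_norm (f (x + h) - f x) \<le> K * euclid_norm h"
proof -
  have A: "A \<in> carrier_mat q d"
    using jac by (simp add: has_vec_jacobian_def)
  obtain K where K: "K > 0" "\<And>x. x \<in> carrier_vec d \<Longrightarrow> euclid_norm (A *\<^sub>v x) \<le> K * euclid_norm x"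
    using mult_mat_vec_bounded[OF A] by blast
  obtain r where r: "r > 0" "\<And>v. v \<in> carrier_vec d \<Longrightarrow> euclid_norm v < r \<Longrightarrow>
      euclid_norm (f (x + v) - f x - A *\<^sub>v v) \<le> 1 * euclid_norm v"
    using has_vec_jacobianE[OF jac, of 1] by auto
  show ?thesis
  proof (rule that)
    show "K + 1 > 0" "r > 0"
      using K r by auto
    fix h :: "real vec" assume h: "h \<in> carrier_vec d" "euclid_norm h < r"
    have fc: "f (x + h) \<in> carrier_vec q" "f x \<in> carrier_vec q"
      using f x h by auto
    have "f (x + h) - f x = (f (x + h) - f x - A *\<^sub>v h) + A *\<^sub>v h"
      using fc A by (intro eq_vecI) auto
    also have "euclid_norm \<dots> \<le> euclid_norm (f (x + h) - f x - A *\<^sub>v h) + euclid_norm (A *\<^sub>v h)"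
      using fc A by (intro euclid_norm_add_le) auto
    also have "\<dots> \<le> (K + 1) * euclid_norm h"
      using r(2)[OF h] K(2)[OF h(1)] by (simp add: distrib_right)
    finally show "euclid_norm (f (x + h) - f x) \<le> (K + 1) * euclid_norm h" .
  qed
qed

lemma has_vec_jacobian_compose:
  assumes f: "f \<in> carrier_vec d \<rightarrow> carrier_vec q" and g: "g \<in> carrier_vec q \<rightarrow> carrier_vec p"
    and x: "x \<in> carrier_vec d"
    and fA: "has_vec_jacobian d q f x A" and gB: "has_vec_jacobian q p g (f x) B"
  shows "has_vec_jacobian d p (\<lambda>x. g (f x)) x (B * A)"
  unfolding has_vec_jacobian_def
proof (intro conjI allI impI)
  have A: "A \<in> carrier_mat q d" and B: "B \<in> carrier_mat p q"
    using fA gB by (auto simp: has_vec_jacobian_def)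
  then show "B * A \<in> carrier_mat p d"
    by simp
  obtain K where K: "K > 0" "\<And>x. x \<in> carrier_vec q \<Longrightarrow> euclid_norm (B *\<^sub>v x) \<le> K * euclid_norm x"
    using mult_mat_vec_bounded[OF B] by blast
  obtain M s where M: "M > 0" and s: "s > 0" and lip: "\<And>h. h \<in> carrier_vec d \<Longrightarrow>
      euclid_norm h < s \<Longrightarrow> euclid_norm (f (x + h) - f x) \<le> M * euclid_norm h"
    using has_vec_jacobian_lipschitz_at[OF fA f x] by blast
  fix e :: real assume e: "e > 0"
  obtain r1 where r1: "r1 > 0" "\<And>v. v \<in> carrier_vec q \<Longrightarrow> euclid_norm v < r1 \<Longrightarrow>
      euclid_norm (g (f x + v) - g (f x) - B *\<^sub>v v) \<le> e / (2 * M) * euclid_norm v"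
    using has_vec_jacobianE[OF gB, of "e / (2 * M)"] e M by auto
  obtain r2 where r2: "r2 > 0" "\<And>v. v \<in> carrier_vec d \<Longrightarrow> euclid_norm v < r2 \<Longrightarrow>
      euclid_norm (f (x + v) - f x - A *\<^sub>v v) \<le> e / (2 * K) * euclid_norm v"
    using has_vec_jacobianE[OF fA, of "e / (2 * K)"] e K(1) by auto
  show "\<exists>r>0. \<forall>h\<in>carrier_vec d. euclid_norm h < r \<longrightarrow>
      euclid_norm (g (f (x + h)) - g (f x) - B * A *\<^sub>v h) \<le> e * euclid_norm h"
  proof (intro exI conjI ballI impI)
    show "min s (min r2 (r1 / M)) > 0"
      using s r1 r2 M by simp
    fix h :: "real vec" assume h: "h \<in> carrier_vec d" and small: "euclid_norm h < min s (min r2 (r1 / M))"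
    define v where "v = f (x + h) - f x"
    have fc: "f (x + h) \<in> carrier_vec q" "f x \<in> carrier_vec q"
      using f x h by auto
    then have v: "v \<in> carrier_vec q"
      by (simp add: v_def)
    have fv: "f x + v = f (x + h)"
      unfolding v_def using fc by (intro eq_vecI) auto
    have gc: "g (f (x + h)) \<in> carrier_vec p" "g (f x) \<in> carrier_vec p"
      using fc g by auto
    have Mv: "euclid_norm v \<le> M * euclid_norm h"
      unfolding v_def using lip[OF h] small by simp
    also have "\<dots> < r1"
      using small M by (simp add: pos_less_divide_eq mult.commute)
    finally have "euclid_norm (g (f (x + h)) - g (f x) - B *\<^sub>v v) \<le> e / (2 * M) * euclid_norm v"
      using r1(2)[OF v] by (simp add: fv)
    also have "\<dots> \<le> e / (2 * M) * (M * euclid_norm h)"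
      using e M by (intro mult_left_mono Mv) simp
    finally have one: "euclid_norm (g (f (x + h)) - g (f x) - B *\<^sub>v v) \<le> e / 2 * euclid_norm h"
      using M by simp
    have "euclid_norm (B *\<^sub>v (v - A *\<^sub>v h)) \<le> K * euclid_norm (v - A *\<^sub>v h)"
      using v A h by (intro K) auto
    also have "\<dots> \<le> K * (e / (2 * K) * euclid_norm h)"
      using r2(2)[OF h] small K(1) by (intro mult_left_mono) (auto simp: v_def)
    finally have two: "euclid_norm (B *\<^sub>v (v - A *\<^sub>v h)) \<le> e / 2 * euclid_norm h"
      using K(1) by simp
    have "B *\<^sub>v (v - A *\<^sub>v h) = B *\<^sub>v v - B * A *\<^sub>v h"
      using mult_minus_distrib_mat_vec[OF B v, of "A *\<^sub>v h"] A B h by simp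
    then have "g (f (x + h)) - g (f x) - B * A *\<^sub>v h
        = (g (f (x + h)) - g (f x) - B *\<^sub>v v) + B *\<^sub>v (v - A *\<^sub>v h)"
      using gc A B by (intro eq_vecI) auto
    also have "euclid_norm \<dots> \<le> euclid_norm (g (f (x + h)) - g (f x) - B *\<^sub>v v)
        + euclid_norm (B *\<^sub>v (v - A *\<^sub>v h))"
      using gc A B by (intro euclid_norm_add_le) auto
    finally show "euclid_norm (g (f (x + h)) - g (f x) - B * A *\<^sub>v h) \<le> e * euclid_norm h"
      using one two by linarith
  qed
qed

section \<open>Continuously differentiable maps\<close>

lemma scalar_vec_carrier [simp]: "scalar_vec a \<in> carrier_vec (Suc 0)"
  by (simp add: scalar_vec_def)

lemma scalar_vec_index [simp]: "scalar_vec a $ 0 = a"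
  by (simp add: scalar_vec_def)

lemma vec_C1_scalar_imp_continuous:
  assumes "vec_C1 d 1 (\<lambda>x. scalar_vec (g x))"
  shows "vec_continuous d g"
  unfolding vec_continuous_def
proof (intro ballI allI impI)
  fix x :: "real vec" and e :: real assume x: "x \<in> carrier_vec d" and e: "e > 0"
  obtain A where A: "has_vec_jacobian d 1 (\<lambda>x. scalar_vec (g x)) x A"
    using assms x by (auto simp: vec_C1_def vec_differentiable_def)
  obtain K r where K: "K > 0" and r: "r > 0" and lip: "\<And>h. h \<in> carrier_vec d \<Longrightarrow>
      euclid_norm h < r \<Longrightarrow> euclid_norm (scalar_vec (g (x + h)) - scalar_vec (g x)) \<le> K * euclid_norm h"
    using has_vec_jacobian_lipschitz_at[OF A _ x] by auto
  show "\<exists>r>0. \<forall>z\<in>carrier_vec d. euclid_norm (z - x) < r \<longrightarrow> \<bar>g z - g x\<bar> < e"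
  proof (intro exI conjI ballI impI)
    show "min r (e / K) > 0"
      using r e K by simp
    fix z :: "real vec" assume z: "z \<in> carrier_vec d" and small: "euclid_norm (z - x) < min r (e / K)"
    have "x + (z - x) = z"
      using x z by (intro eq_vecI) auto
    then have "euclid_norm (scalar_vec (g z) - scalar_vec (g x)) \<le> K * euclid_norm (z - x)"
      using lip[of "z - x"] x z small by simp
    also have "\<dots> < e"
      using small K by (simp add: pos_less_divide_eq mult.commute)
    finally have "euclid_norm (scalar_vec (g z) - scalar_vec (g x)) < e" .
    then show "\<bar>g z - g x\<bar> < e"
      using abs_index_le_euclid_norm[of 0 "scalar_vec (g z) - scalar_vec (g x)"]
      by (simp add: scalar_vec_def)
  qed
qed

lemma vec_C2_imp_C1: "vec_C2 d q f \<Longrightarrow> vec_C1 d q f"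
  unfolding vec_C2_def by (auto simp: vec_C1_def[of d q f] intro: vec_C1_scalar_imp_continuous)

text \<open>
The error vector \<open>w = f (x + h) - f x - M h\<close> itself serves as the test direction: the
  one-dimensional mean value theorem for \<open>t \<mapsto> w \<bullet> f (x + t h)\<close> gives
  \<open>w \<bullet> w = w \<bullet> (A t h - M h)\<close> at some \<open>t\<close>, and Cauchy--Schwarz cancels one factor of the norm of \<open>w\<close>.
\<close>

lemma mean_value_bound:
  assumes f: "f \<in> carrier_vec d \<rightarrow> carrier_vec q"
    and x: "x \<in> carrier_vec d" and h: "h \<in> carrier_vec d" and M: "M \<in> carrier_mat q d"
    and jac: "\<And>t. 0 \<le> t \<Longrightarrow> t \<le> 1 \<Longrightarrow> has_vec_jacobian d q f (x + t \<cdot>\<^sub>v h) (A t)"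
    and bound: "\<And>t. 0 \<le> t \<Longrightarrow> t \<le> 1 \<Longrightarrow> euclid_norm (A t *\<^sub>v h - M *\<^sub>v h) \<le> b"
  shows "euclid_norm (f (x + h) - f x - M *\<^sub>v h) \<le> b"
proof -
  define w where "w = f (x + h) - f x - M *\<^sub>v h"
  define phi where "phi t = (\<Sum>i<q. w $ i * f (x + t \<cdot>\<^sub>v h) $ i)" for t
  have fc: "f (x + h) \<in> carrier_vec q" "f x \<in> carrier_vec q"
    using f x h by auto
  have w: "w \<in> carrier_vec q"
    using M by (intro carrier_vecI) (simp add: w_def)
  have "(phi has_real_derivative (\<Sum>i<q. w $ i * (A t *\<^sub>v h) $ i)) (at t)" if "0 \<le> t" "t \<le> 1" for t
    unfolding phi_def
    by (intro DERIV_sum DERIV_cmult has_vec_jacobian_line_index[OF jac[OF that] f x h]) simp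
  then obtain t where t: "0 < t" "t < 1" and "phi 1 - phi 0 = (1 - 0) * (\<Sum>i<q. w $ i * (A t *\<^sub>v h) $ i)"
    using MVT2[of 0 1 phi "\<lambda>t. \<Sum>i<q. w $ i * (A t *\<^sub>v h) $ i"] by auto
  moreover have "x + 1 \<cdot>\<^sub>v h = x + h" "x + 0 \<cdot>\<^sub>v h = x"
    using x h by (auto intro!: eq_vecI)
  ultimately have "(\<Sum>i<q. w $ i * f (x + h) $ i) - (\<Sum>i<q. w $ i * f x $ i)
      = (\<Sum>i<q. w $ i * (A t *\<^sub>v h) $ i)"
    by (simp add: phi_def)
  moreover have At: "A t \<in> carrier_mat q d"
    using jac[of t] t by (simp add: has_vec_jacobian_def)
  ultimately have "w \<bullet> w = w \<bullet> (A t *\<^sub>v h - M *\<^sub>v h)"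
    using M fc w by (simp add: scalar_prod_def w_def atLeast0LessThan right_diff_distrib sum_subtractf)
  also have "\<dots> \<le> euclid_norm w * euclid_norm (A t *\<^sub>v h - M *\<^sub>v h)"
    using abs_scalar_prod_le[of w "A t *\<^sub>v h - M *\<^sub>v h"] w M by simp
  also have "\<dots> \<le> euclid_norm w * b"
    using t by (intro mult_left_mono bound) auto
  finally have "euclid_norm w * euclid_norm w \<le> euclid_norm w * b"
    by (simp add: euclid_norm_squared[symmetric] power2_eq_square)
  moreover have "0 \<le> b"
    using bound[of t] t euclid_norm_nonneg[of "A t *\<^sub>v h - M *\<^sub>v h"] by linarith
  ultimately have "euclid_norm w \<le> b"
    using euclid_norm_nonneg[of w] by (cases "euclid_norm w = 0") (auto simp: mult_le_cancel_left)
  then show ?thesis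
    by (simp add: w_def)
qed

lemma vec_jacobian_continuous:
  assumes C1: "vec_C1 d q f" and f: "f \<in> carrier_vec d \<rightarrow> carrier_vec q"
    and x: "x \<in> carrier_vec d" and e: "e > 0"
  obtains r where "r > 0" "\<And>z h. z \<in> carrier_vec d \<Longrightarrow> h \<in> carrier_vec d \<Longrightarrow> euclid_norm (z - x) < r \<Longrightarrow>
     euclid_norm (vec_jacobian d q f z *\<^sub>v h - vec_jacobian d q f x *\<^sub>v h) \<le> e * euclid_norm h"
proof -
  let ?J = "vec_jacobian d q f" and ?c = "e / (real (q * d) + 1)"
  \<comment> \<open>There are \<open>q * d\<close> entries; the summand 1 covers the case of no entries.\<close>
  have c: "?c > 0"
    using e by (intro divide_pos_pos add_nonneg_pos of_nat_0_le_iff) simp_all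
  have carr: "?J z \<in> carrier_mat q d" if "z \<in> carrier_vec d" for z
    using has_vec_jacobian_vec_jacobian[of d q f z] C1 f that
    by (simp add: vec_C1_def has_vec_jacobian_def)
  have "\<exists>r>0. \<forall>z\<in>carrier_vec d. euclid_norm (z - x) < r \<longrightarrow> \<bar>?J z $$ p - ?J x $$ p\<bar> < ?c"
    if "p \<in> {..<q} \<times> {..<d}" for p
    using C1 x c that unfolding vec_C1_def vec_continuous_def by auto
  then obtain R where R: "\<And>p. p \<in> {..<q} \<times> {..<d} \<Longrightarrow> R p > 0 \<and>
      (\<forall>z\<in>carrier_vec d. euclid_norm (z - x) < R p \<longrightarrow> \<bar>?J z $$ p - ?J x $$ p\<bar> < ?c)"
    by metis
  define r where "r = Min (insert 1 (R ` ({..<q} \<times> {..<d})))"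
  have rR: "r \<le> R p" if "p \<in> {..<q} \<times> {..<d}" for p
    unfolding r_def using that by (intro Min_le) auto
  show ?thesis
  proof (rule that)
    show "r > 0"
      unfolding r_def using R by (subst Min_gr_iff) auto
    fix z h :: "real vec"
    assume z: "z \<in> carrier_vec d" and h: "h \<in> carrier_vec d" and small: "euclid_norm (z - x) < r"
    have "\<bar>(?J z - ?J x) $$ (i, j)\<bar> \<le> ?c" if "i < q" "j < d" for i j
    proof -
      have "\<bar>?J z $$ (i, j) - ?J x $$ (i, j)\<bar> < ?c"
        using R[of "(i, j)"] rR[of "(i, j)"] z small that by auto
      then show ?thesis
        using carr[OF z] carr[OF x] that by simp
    qed
    then have "(\<Sum>i<q. \<Sum>j<d. \<bar>(?J z - ?J x) $$ (i, j)\<bar>) \<le> (\<Sum>i<q. \<Sum>j<d. ?c)"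
      by (intro sum_mono) auto
    also have "\<dots> = (real (q * d) * e) / (real (q * d) + 1)"
      by simp
    also have "\<dots> \<le> e"
    proof (subst pos_divide_le_eq)
      show "real (q * d) + 1 > 0"
        by (intro add_nonneg_pos of_nat_0_le_iff) simp
      show "real (q * d) * e \<le> e * (real (q * d) + 1)"
        using e by (simp add: algebra_simps)
    qed
    finally have "(\<Sum>i<q. \<Sum>j<d. \<bar>(?J z - ?J x) $$ (i, j)\<bar>) * euclid_norm h \<le> e * euclid_norm h"
      by (intro mult_right_mono) auto
    moreover have "?J z *\<^sub>v h - ?J x *\<^sub>v h = (?J z - ?J x) *\<^sub>v h"
      using minus_mult_distrib_mat_vec[OF carr[OF z] carr[OF x] h] by simp
    moreover have "?J z - ?J x \<in> carrier_mat q d"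
      using carr[OF x] by (rule minus_carrier_mat)
    ultimately show "euclid_norm (?J z *\<^sub>v h - ?J x *\<^sub>v h) \<le> e * euclid_norm h"
      using euclid_norm_mult_mat_vec_le[of "?J z - ?J x" q d h] h by simp
  qed
qed

text \<open>
The linearisation at \<open>x\<close> approximates differences between \<^emph>\<open>any\<close> two points near \<open>x\<close>, by the mean
  value bound on the segment joining them, which stays in the ball.  Differentiability at \<open>x\<close> alone would only
  allow \<open>x\<close> as one of the two points, and would not give a contraction.
\<close>

lemma vec_C1_strictly_differentiable:
  assumes C1: "vec_C1 d q f" and f: "f \<in> carrier_vec d \<rightarrow> carrier_vec q"
    and x: "x \<in> carrier_vec d" and e: "e > 0"
  obtains r where "r > 0" "\<And>z z'. z \<in> carrier_vec d \<Longrightarrow> z' \<in> carrier_vec d \<Longrightarrow>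
     euclid_norm (z - x) < r \<Longrightarrow> euclid_norm (z' - x) < r \<Longrightarrow>
     euclid_norm (f z - f z' - vec_jacobian d q f x *\<^sub>v (z - z')) \<le> e * euclid_norm (z - z')"
proof -
  let ?J = "vec_jacobian d q f"
  have jac: "has_vec_jacobian d q f z (?J z)" if "z \<in> carrier_vec d" for z
    using has_vec_jacobian_vec_jacobian[of d q f z] C1 f that by (simp add: vec_C1_def)
  obtain r where r: "r > 0" "\<And>z h. z \<in> carrier_vec d \<Longrightarrow> h \<in> carrier_vec d \<Longrightarrow> euclid_norm (z - x) < r \<Longrightarrow>
     euclid_norm (?J z *\<^sub>v h - ?J x *\<^sub>v h) \<le> e * euclid_norm h"
    using vec_jacobian_continuous[OF C1 f x e] by blast
  show ?thesis
  proof (rule that[OF r(1)])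
    fix z z' :: "real vec"
    assume z: "z \<in> carrier_vec d" "euclid_norm (z - x) < r"
      and z': "z' \<in> carrier_vec d" "euclid_norm (z' - x) < r"
    have "euclid_norm (f (z' + (z - z')) - f z' - ?J x *\<^sub>v (z - z')) \<le> e * euclid_norm (z - z')"
    proof (rule mean_value_bound[where A = "\<lambda>t. ?J (z' + t \<cdot>\<^sub>v (z - z'))"])
      fix t :: real assume t: "0 \<le> t" "t \<le> 1"
      have "z' + t \<cdot>\<^sub>v (z - z') - x = (1 - t) \<cdot>\<^sub>v (z' - x) + t \<cdot>\<^sub>v (z - x)"
        using x z z' by (intro eq_vecI) (auto simp: algebra_simps)
      also have "euclid_norm \<dots> \<le> (1 - t) * euclid_norm (z' - x) + t * euclid_norm (z - x)"
        using euclid_norm_add_le[of "(1 - t) \<cdot>\<^sub>v (z' - x)" "t \<cdot>\<^sub>v (z - x)"] t x z z'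
        by (simp add: euclid_norm_smult)
      also have "\<dots> < r"
        using t z(2) z'(2) by (intro convex_bound_lt) auto
      finally show "euclid_norm (?J (z' + t \<cdot>\<^sub>v (z - z')) *\<^sub>v (z - z') - ?J x *\<^sub>v (z - z')) \<le> e * euclid_norm (z - z')"
        using x z z' by (intro r) auto
      show "has_vec_jacobian d q f (z' + t \<cdot>\<^sub>v (z - z')) (?J (z' + t \<cdot>\<^sub>v (z - z')))"
        using z z' by (intro jac) auto
    qed (use f x z z' jac[OF x] in \<open>auto simp: has_vec_jacobian_def\<close>)
    moreover have "z' + (z - z') = z"
      using z z' by (intro eq_vecI) auto
    ultimately show "euclid_norm (f z - f z' - ?J x *\<^sub>v (z - z')) \<le> e * euclid_norm (z - z')"
      by simp
  qed
qed

section \<open>Implicit functions\<close>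

lemma tendsto_euclid_norm_diff:
  assumes X: "\<And>n. X n \<in> carrier_vec d" and l: "l \<in> carrier_vec d" and z: "z \<in> carrier_vec d"
    and lim: "\<And>i. i < d \<Longrightarrow> (\<lambda>n. X n $ i) \<longlonglongrightarrow> l $ i"
  shows "(\<lambda>n. euclid_norm (X n - z)) \<longlonglongrightarrow> euclid_norm (l - z)"
proof -
  have norm: "euclid_norm (v - z) = sqrt (\<Sum>i<d. (v $ i - z $ i)\<^sup>2)" for v
    using z by (simp add: euclid_norm_eq_L2_set L2_set_def atLeast0LessThan)
  show ?thesis
    unfolding norm by (intro tendsto_intros lim) auto
qed

text \<open>
Only the ball of radius \<open>2 * delta\<close> matters, where \<open>delta\<close> is the length of the first step:
  successive steps at least halve, so the iterates never leave it.  The bound on the distance of the fixed point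
  to the start is what makes the implicit function Lipschitz at the base point.
\<close>

lemma contraction_fixed_point:
  assumes Phi: "Phi \<in> carrier_vec d \<rightarrow> carrier_vec d" and y0: "y0 \<in> carrier_vec d"
    and delta: "euclid_norm (Phi y0 - y0) = delta"
    and contr: "\<And>y y'. y \<in> carrier_vec d \<Longrightarrow> y' \<in> carrier_vec d \<Longrightarrow>
      euclid_norm (y - y0) \<le> 2 * delta \<Longrightarrow> euclid_norm (y' - y0) \<le> 2 * delta \<Longrightarrow>
      euclid_norm (Phi y - Phi y') \<le> euclid_norm (y - y') / 2"
  obtains y where "y \<in> carrier_vec d" "euclid_norm (y - y0) \<le> 2 * delta" "Phi y = y"
proof -
  define X where "X n = (Phi ^^ n) y0" for n
  have X_0: "X 0 = y0" and X_Suc: "X (Suc n) = Phi (X n)" for n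
    by (simp_all add: X_def)
  have X: "X n \<in> carrier_vec d" for n
    by (induction n) (use Phi y0 in \<open>auto simp: X_0 X_Suc\<close>)
  have delta0: "0 \<le> delta"
    using delta euclid_norm_nonneg by blast
  have step: "euclid_norm (X n - y0) \<le> 2 * delta * (1 - (1/2) ^ n) \<and>
      euclid_norm (X (Suc n) - X n) \<le> delta * (1/2) ^ n" for n
  proof (induction n)
    case 0
    then show ?case
      using delta y0 by (simp add: X_0 X_Suc)
  next
    case (Suc n)
    have "euclid_norm (X (Suc n) - y0) \<le> euclid_norm (X (Suc n) - X n) + euclid_norm (X n - y0)"
      using X[of n] X[of "Suc n"] y0 by (intro euclid_norm_diff_triangle) simp_all
    also have "\<dots> \<le> 2 * delta * (1 - (1/2) ^ Suc n)"
      using Suc by (simp add: algebra_simps)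
    finally have ball: "euclid_norm (X (Suc n) - y0) \<le> 2 * delta * (1 - (1/2) ^ Suc n)" .
    have in_ball: "2 * delta * (1 - (1/2) ^ k) \<le> 2 * delta" for k
      using delta0 by (simp add: algebra_simps)
    have "euclid_norm (X (Suc (Suc n)) - X (Suc n)) \<le> euclid_norm (X (Suc n) - X n) / 2"
      unfolding X_Suc[of "Suc n"] X_Suc[of n]
      using X ball Suc.IH in_ball[of n] in_ball[of "Suc n"]
      by (intro contr) (auto simp flip: X_Suc intro: order_trans)
    also have "\<dots> \<le> delta * (1/2) ^ Suc n"
      using Suc.IH by simp
    finally show ?case
      using ball by blast
  qed
  \<comment> \<open>Summing the geometric bounds on the steps beyond index \<open>n\<close>.\<close>
  have tail: "euclid_norm (X (m + n) - X n) \<le> 2 * delta * (1/2) ^ n * (1 - (1/2) ^ m)" for m n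
  proof (induction m)
    case 0
    then show ?case
      using X[of n] by simp
  next
    case (Suc m)
    have "euclid_norm (X (Suc m + n) - X n)
        \<le> euclid_norm (X (Suc (m + n)) - X (m + n)) + euclid_norm (X (m + n) - X n)"
      using X[of n] X[of "m + n"] X[of "Suc (m + n)"]
      by (simp only: add_Suc, intro euclid_norm_diff_triangle) simp_all
    also have "\<dots> \<le> delta * (1/2) ^ (m + n) + 2 * delta * (1/2) ^ n * (1 - (1/2) ^ m)"
      using step[of "m + n"] Suc by linarith
    also have "\<dots> = 2 * delta * (1/2) ^ n * (1 - (1/2) ^ Suc m)"
      by (simp add: algebra_simps power_add)
    finally show ?case .
  qed
  \<comment> \<open>Each coordinate converges because its increments are absolutely summable.\<close>
  have "\<exists>l. (\<lambda>n. X n $ i) \<longlonglongrightarrow> l" if i: "i < d" for i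
  proof -
    have "summable (\<lambda>n. X (Suc n) $ i - X n $ i)"
    proof (rule summable_comparison_test)
      have "\<bar>X (Suc n) $ i - X n $ i\<bar> \<le> delta * (1/2) ^ n" for n
        using abs_index_le_euclid_norm[of i "X (Suc n) - X n"] step[of n] i X[of n] by simp
      then show "\<exists>N. \<forall>n\<ge>N. norm (X (Suc n) $ i - X n $ i) \<le> delta * (1/2) ^ n"
        by auto
      show "summable (\<lambda>n. delta * (1/2 :: real) ^ n)"
        by (intro summable_mult summable_geometric) simp
    qed
    then have "(\<lambda>n. X n $ i - X 0 $ i) \<longlonglongrightarrow> (\<Sum>n. X (Suc n) $ i - X n $ i)"
      using summable_LIMSEQ[of "\<lambda>n. X (Suc n) $ i - X n $ i"]
        sum_lessThan_telescope[of "\<lambda>n. X n $ i"] by simp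
    then have "(\<lambda>n. X n $ i - X 0 $ i + X 0 $ i) \<longlonglongrightarrow> (\<Sum>n. X (Suc n) $ i - X n $ i) + X 0 $ i"
      by (intro tendsto_intros)
    then show ?thesis
      by auto
  qed
  then obtain L where L: "\<And>i. i < d \<Longrightarrow> (\<lambda>n. X n $ i) \<longlonglongrightarrow> L i"
    by metis
  define l where "l = vec d L"
  have l: "l \<in> carrier_vec d"
    by (simp add: l_def)
  have dist: "euclid_norm (l - X n) \<le> 2 * delta * (1/2) ^ n" for n
  proof (rule LIMSEQ_le_const2)
    show "(\<lambda>m. euclid_norm (X (m + n) - X n)) \<longlonglongrightarrow> euclid_norm (l - X n)"
      using X l L by (intro tendsto_euclid_norm_diff) (auto simp: l_def intro: LIMSEQ_ignore_initial_segment)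
    have "euclid_norm (X (m + n) - X n) \<le> 2 * delta * (1/2) ^ n" for m
    proof -
      have "2 * delta * (1/2) ^ n * (1 - (1/2) ^ m) \<le> 2 * delta * (1/2) ^ n"
        using delta0 by (intro mult_left_le) auto
      then show ?thesis
        using tail[of m n] by linarith
    qed
    then show "\<exists>N. \<forall>m\<ge>N. euclid_norm (X (m + n) - X n) \<le> 2 * delta * (1/2) ^ n"
      by blast
  qed
  have "euclid_norm (Phi l - l) \<le> 2 * delta * (1/2) ^ n" for n
  proof -
    have Pl: "Phi l \<in> carrier_vec d"
      using Phi l by auto
    have "2 * delta * (1 - (1/2) ^ n) \<le> 2 * delta"
      using delta0 by (simp add: algebra_simps)
    then have "euclid_norm (Phi l - X (Suc n)) \<le> euclid_norm (l - X n) / 2"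
      unfolding X_Suc using l X dist[of 0] step[of n] by (intro contr) (auto simp: X_0)
    moreover have "euclid_norm (Phi l - l) \<le> euclid_norm (Phi l - X (Suc n)) + euclid_norm (X (Suc n) - l)"
      using Pl l X[of "Suc n"] by (intro euclid_norm_diff_triangle) simp_all
    moreover have "euclid_norm (X (Suc n) - l) = euclid_norm (l - X (Suc n))"
      using l X[of "Suc n"] by (intro euclid_norm_minus_commute) simp
    ultimately show ?thesis
      using dist[of n] dist[of "Suc n"] by simp
  qed
  moreover have "(\<lambda>n. 2 * delta * (1/2 :: real) ^ n) \<longlonglongrightarrow> 2 * delta * 0"
    by (intro tendsto_intros LIMSEQ_power_zero) simp
  ultimately have "euclid_norm (Phi l - l) \<le> 2 * delta * 0"
    by (intro LIMSEQ_le_const) auto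
  then have "euclid_norm (Phi l - l) = 0"
    using euclid_norm_nonneg[of "Phi l - l"] by simp
  then have eq: "Phi l - l = 0\<^sub>v d"
    using euclid_norm_eq_0_iff[of "Phi l - l" d] l funcset_mem[OF Phi l] by simp
  have "Phi l = l"
  proof (rule eq_vecI)
    fix i assume i: "i < dim_vec l"
    then have "(Phi l - l) $ i = 0\<^sub>v d $ i"
      using eq by simp
    then show "Phi l $ i = l $ i"
      using i l by simp
  qed (use funcset_mem[OF Phi l] l in simp)
  with l dist[of 0] show ?thesis
    by (intro that[of l]) (auto simp: X_0)
qed

text \<open>
The partial derivatives are read off the joint Jacobian \<open>M\<close> by padding with zeros, and \<open>B\<close> inverts
  the partial derivative with respect to the implicitly determined variable.  No continuity of \<open>sol\<close> is assumed:
  the fixed point of \<open>y \<mapsto> y - B F(y, u)\<close> near \<open>sol u0\<close> is a zero of \<open>F (\<cdot>, u)\<close>, and \<open>unique\<close> identifies it with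
  \<open>sol u\<close>.
\<close>

lemma implicit_function_differentiable:
  fixes n m :: nat and F sol :: "real vec \<Rightarrow> real vec" and u0 :: "real vec"
  defines "M \<equiv> vec_jacobian (n + m) n F (sol u0 @\<^sub>v u0)"
  assumes C1: "vec_C1 (n + m) n F" and F: "F \<in> carrier_vec (n + m) \<rightarrow> carrier_vec n"
    and sol: "\<And>u. u \<in> carrier_vec m \<Longrightarrow> sol u \<in> carrier_vec n \<and> F (sol u @\<^sub>v u) = 0\<^sub>v n"
    and unique: "\<And>u y. u \<in> carrier_vec m \<Longrightarrow> y \<in> carrier_vec n \<Longrightarrow> F (y @\<^sub>v u) = 0\<^sub>v n \<Longrightarrow> y = sol u"
    and u0: "u0 \<in> carrier_vec m" and B: "B \<in> carrier_mat n n"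
    and left: "\<And>v. v \<in> carrier_vec n \<Longrightarrow> B *\<^sub>v (M *\<^sub>v (v @\<^sub>v 0\<^sub>v m)) = v"
    and right: "\<And>v. v \<in> carrier_vec n \<Longrightarrow> M *\<^sub>v ((B *\<^sub>v v) @\<^sub>v 0\<^sub>v m) = v"
  obtains Z where "has_vec_jacobian m n sol u0 Z"
proof -
  define y0 where "y0 = sol u0"
  define z0 where "z0 = y0 @\<^sub>v u0"
  have y0: "y0 \<in> carrier_vec n" and z0: "z0 \<in> carrier_vec (n + m)" and Fz0: "F z0 = 0\<^sub>v n"
    using sol[OF u0] u0 by (auto simp: y0_def z0_def)
  have jac: "has_vec_jacobian (n + m) n F z0 (M)"
    using has_vec_jacobian_vec_jacobian[OF _ F z0] C1
    by (simp add: vec_C1_def M_def z0_def y0_def)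
  then have M: "M \<in> carrier_mat n (n + m)"
    by (simp add: has_vec_jacobian_def)
  obtain K where K: "K > 0" "\<And>x. x \<in> carrier_vec n \<Longrightarrow> euclid_norm (B *\<^sub>v x) \<le> K * euclid_norm x"
    using mult_mat_vec_bounded[OF B] by blast
  \<comment> \<open>With this tolerance, applying \<open>B\<close> to the linearisation error gives contraction factor 1/2.\<close>
  have "1 / (2 * K) > 0"
    using K by simp
  then obtain r where r: "r > 0" and strict: "\<And>z z'. z \<in> carrier_vec (n + m) \<Longrightarrow> z' \<in> carrier_vec (n + m) \<Longrightarrow>
     euclid_norm (z - z0) < r \<Longrightarrow> euclid_norm (z' - z0) < r \<Longrightarrow>
     euclid_norm (F z - F z' - M *\<^sub>v (z - z')) \<le> 1 / (2 * K) * euclid_norm (z - z')"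
    using vec_C1_strictly_differentiable[OF C1 F z0, of "1 / (2 * K)"]
    unfolding M_def z0_def y0_def by blast
  obtain K1 r1 where K1: "K1 > 0" and r1: "r1 > 0" and lip: "\<And>h. h \<in> carrier_vec (n + m) \<Longrightarrow>
      euclid_norm h < r1 \<Longrightarrow> euclid_norm (F (z0 + h) - F z0) \<le> K1 * euclid_norm h"
    using has_vec_jacobian_lipschitz_at[OF jac F z0] by blast
  \<comment> \<open>\<open>Q\<close> will be a Lipschitz constant of \<open>sol\<close> at \<open>u0\<close>: the first step of the iteration from \<open>y0\<close> has
    length at most \<open>K * K1\<close> times the distance of the parameters.\<close>
  define Q where "Q = 2 * (K * K1)"
  have Q: "Q > 0"
    using K K1 by (simp add: Q_def)
  define s where "s = min r1 (r / (Q + 1))"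
  have s: "s > 0"
    using r r1 Q by (simp add: s_def)
  have near: "euclid_norm (sol (u0 + h) - y0) \<le> Q * euclid_norm h"
    if h: "h \<in> carrier_vec m" and small: "euclid_norm h < s" for h
  proof -
    define u where "u = u0 + h"
    define Phi where "Phi y = y - B *\<^sub>v F (y @\<^sub>v u)" for y
    have u: "u \<in> carrier_vec m" and uh: "u - u0 = h"
      using u0 h by (auto simp: u_def)
    have Fc: "F (y @\<^sub>v u) \<in> carrier_vec n" if "y \<in> carrier_vec n" for y
      using F that u by auto
    have z_diff: "(y @\<^sub>v u) - z0 = (y - y0) @\<^sub>v h" if "y \<in> carrier_vec n" for y
      using append_vec_diff[OF that y0 u u0] uh by (simp add: z0_def)
    have z_norm: "euclid_norm ((y @\<^sub>v u) - z0) \<le> euclid_norm (y - y0) + euclid_norm h"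
      if "y \<in> carrier_vec n" for y
      using z_diff[OF that] euclid_norm_append_le by metis
    have delta: "2 * euclid_norm (Phi y0 - y0) \<le> Q * euclid_norm h"
    proof -
      have "z0 + ((y0 @\<^sub>v u) - z0) = y0 @\<^sub>v u"
        using z0 y0 u by (intro eq_vecI) auto
      moreover have "euclid_norm ((y0 @\<^sub>v u) - z0) \<le> euclid_norm h"
        using z_norm[OF y0] y0 by simp
      moreover have "(y0 @\<^sub>v u) - z0 \<in> carrier_vec (n + m)"
        using z0 y0 u by auto
      ultimately have "euclid_norm (F (y0 @\<^sub>v u) - F z0) \<le> K1 * euclid_norm ((y0 @\<^sub>v u) - z0)"
        using lip[of "(y0 @\<^sub>v u) - z0"] small by (simp add: s_def)
      also have "\<dots> \<le> K1 * euclid_norm h"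
        using K1 z_norm[OF y0] y0 by (intro mult_left_mono) auto
      finally have "euclid_norm (F (y0 @\<^sub>v u)) \<le> K1 * euclid_norm h"
        using Fc[OF y0] by (simp add: Fz0)
      then have "K * euclid_norm (F (y0 @\<^sub>v u)) \<le> K * (K1 * euclid_norm h)"
        using K by (intro mult_left_mono) auto
      moreover have "Phi y0 - y0 = - (B *\<^sub>v F (y0 @\<^sub>v u))"
        unfolding Phi_def using y0 B Fc[OF y0] by (intro eq_vecI) auto
      ultimately show ?thesis
        using K(2)[OF Fc[OF y0]] by (simp add: euclid_norm_uminus Q_def)
    qed
    have contr: "euclid_norm (Phi y - Phi y') \<le> euclid_norm (y - y') / 2"
      if y: "y \<in> carrier_vec n" "euclid_norm (y - y0) \<le> Q * euclid_norm h"
        and y': "y' \<in> carrier_vec n" "euclid_norm (y' - y0) \<le> Q * euclid_norm h" for y y'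
    proof -
      let ?D = "F (y @\<^sub>v u) - F (y' @\<^sub>v u)" and ?d = "(y - y') @\<^sub>v 0\<^sub>v m"
      have "(Q + 1) * euclid_norm h < r"
        using small Q by (simp add: s_def pos_less_divide_eq mult.commute)
      then have "euclid_norm ((y @\<^sub>v u) - z0) < r" "euclid_norm ((y' @\<^sub>v u) - z0) < r"
        using z_norm[OF y(1)] z_norm[OF y'(1)] y y' by (simp_all add: algebra_simps)
      moreover have d: "(y @\<^sub>v u) - (y' @\<^sub>v u) = ?d"
        using append_vec_diff[OF y(1) y'(1) u u] u by simp
      ultimately have est: "euclid_norm (?D - M *\<^sub>v ?d) \<le> 1 / (2 * K) * euclid_norm (y - y')"
        using strict[of "y @\<^sub>v u" "y' @\<^sub>v u"] y y' u by (simp add: euclid_norm_append_zero_right)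
      have dc: "?d \<in> carrier_vec (n + m)" "?D \<in> carrier_vec n"
        using y y' Fc by auto
      then have Mdc: "M *\<^sub>v ?d \<in> carrier_vec n"
        using M by simp
      have "Phi y - Phi y' = - (B *\<^sub>v ?D - (y - y'))"
        unfolding Phi_def using B y y' Fc mult_minus_distrib_mat_vec[OF B Fc Fc, of y y']
        by (intro eq_vecI) auto
      also have "y - y' = B *\<^sub>v (M *\<^sub>v ?d)"
        using left[of "y - y'"] y y' by simp
      also have "B *\<^sub>v ?D - B *\<^sub>v (M *\<^sub>v ?d) = B *\<^sub>v (?D - M *\<^sub>v ?d)"
        using mult_minus_distrib_mat_vec[OF B dc(2) Mdc] by simp
      finally have "euclid_norm (Phi y - Phi y') \<le> K * euclid_norm (?D - M *\<^sub>v ?d)"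
        using K(2)[of "?D - M *\<^sub>v ?d"] dc(2) Mdc by (simp add: euclid_norm_uminus)
      also have "\<dots> \<le> K * (1 / (2 * K) * euclid_norm (y - y'))"
        using K est by (intro mult_left_mono) auto
      finally show ?thesis
        using K by simp
    qed
    have "Phi \<in> carrier_vec n \<rightarrow> carrier_vec n"
      using B Fc by (auto simp: Phi_def)
    then obtain y where y: "y \<in> carrier_vec n" "euclid_norm (y - y0) \<le> 2 * euclid_norm (Phi y0 - y0)" "Phi y = y"
      using contraction_fixed_point[OF _ y0 refl, of Phi] contr delta
      by (metis (no_types, lifting) order_trans)
    \<comment> \<open>\<open>B\<close> is injective, so a fixed point is a zero of \<open>F\<close>.\<close>
    have "B *\<^sub>v F (y @\<^sub>v u) = 0\<^sub>v n"
    proof (rule eq_vecI)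
      fix i assume i: "i < dim_vec (0\<^sub>v n :: real vec)"
      have "(y - B *\<^sub>v F (y @\<^sub>v u)) $ i = y $ i"
        using y(3) by (simp add: Phi_def)
      then show "(B *\<^sub>v F (y @\<^sub>v u)) $ i = 0\<^sub>v n $ i"
        using i B by simp
    qed (use B in auto)
    then have "F (y @\<^sub>v u) = M *\<^sub>v (0\<^sub>v n @\<^sub>v 0\<^sub>v m)"
      using right[OF Fc[OF y(1)]] by simp
    also have "\<dots> = 0\<^sub>v n"
    proof -
      have "0\<^sub>v n @\<^sub>v 0\<^sub>v m = (0\<^sub>v (n + m) :: real vec)"
        by (intro eq_vecI) auto
      then show ?thesis
        using M by (auto intro!: eq_vecI)
    qed
    finally have "y = sol u"
      using unique[OF u y(1)] by simp
    then show ?thesis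
      using y(2) delta by (simp add: u_def)
  qed
  define N where "N = M * (0\<^sub>m n m @\<^sub>r 1\<^sub>m m)"
  have E: "0\<^sub>m n m @\<^sub>r 1\<^sub>m m \<in> carrier_mat (n + m) m"
    by (rule carrier_append_rows) auto
  have N: "N \<in> carrier_mat n m"
    unfolding N_def using M E by simp
  have zero: "0\<^sub>m n m *\<^sub>v h = 0\<^sub>v n" if "h \<in> carrier_vec m" for h :: "real vec"
    using that by (intro eq_vecI) auto
  have Nh: "N *\<^sub>v h = M *\<^sub>v (0\<^sub>v n @\<^sub>v h)" if "h \<in> carrier_vec m" for h
    using assoc_mult_mat_vec[OF M E that] mat_mult_append[of "0\<^sub>m n m" n m "1\<^sub>m m" m h] that
    by (simp add: N_def zero)
  have "has_vec_jacobian m n sol u0 (- (B * N))"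
    unfolding has_vec_jacobian_def
  proof (intro conjI allI impI)
    show BN: "- (B * N) \<in> carrier_mat n m"
      using B N by simp
    fix e :: real assume e: "e > 0"
    define e1 where "e1 = e / (K * (Q + 1))"
    have e1: "e1 > 0"
      using e K Q by (simp add: e1_def)
    obtain r2 where r2: "r2 > 0" "\<And>v. v \<in> carrier_vec (n + m) \<Longrightarrow> euclid_norm v < r2 \<Longrightarrow>
        euclid_norm (F (z0 + v) - F z0 - M *\<^sub>v v) \<le> e1 * euclid_norm v"
      using has_vec_jacobianE[OF jac e1] by blast
    show "\<exists>r>0. \<forall>h\<in>carrier_vec m. euclid_norm h < r \<longrightarrow>
        euclid_norm (sol (u0 + h) - sol u0 - (- (B * N)) *\<^sub>v h) \<le> e * euclid_norm h"
    proof (intro exI conjI ballI impI)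
      show "min s (r2 / (Q + 1)) > 0"
        using s r2 Q by simp
      fix h :: "real vec" assume h: "h \<in> carrier_vec m" and small: "euclid_norm h < min s (r2 / (Q + 1))"
      define dy where "dy = sol (u0 + h) - y0"
      have sc: "sol (u0 + h) \<in> carrier_vec n" "F (sol (u0 + h) @\<^sub>v (u0 + h)) = 0\<^sub>v n"
        using sol[of "u0 + h"] u0 h by auto
      have dy: "dy \<in> carrier_vec n"
        using sc y0 by (simp add: dy_def)
      have v: "dy @\<^sub>v h \<in> carrier_vec (n + m)"
        using dy h by auto
      have vn: "euclid_norm (dy @\<^sub>v h) \<le> (Q + 1) * euclid_norm h"
        using euclid_norm_append_le[of dy h] near[OF h] small by (simp add: dy_def algebra_simps)
      also have "\<dots> < r2"
        using small Q by (simp add: pos_less_divide_eq mult.commute)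
      finally have "euclid_norm (F (z0 + (dy @\<^sub>v h)) - F z0 - M *\<^sub>v (dy @\<^sub>v h)) \<le> e1 * euclid_norm (dy @\<^sub>v h)"
        using r2(2)[OF v] by simp
      moreover have "z0 + (dy @\<^sub>v h) = sol (u0 + h) @\<^sub>v (u0 + h)"
        unfolding z0_def dy_def using sc y0 u0 h by (intro eq_vecI) auto
      moreover have "0\<^sub>v n - 0\<^sub>v n - M *\<^sub>v (dy @\<^sub>v h) = - (M *\<^sub>v (dy @\<^sub>v h))"
        using M by (intro eq_vecI) auto
      ultimately have "euclid_norm (M *\<^sub>v (dy @\<^sub>v h)) \<le> e1 * euclid_norm (dy @\<^sub>v h)"
        using sc(2) by (simp add: Fz0 euclid_norm_uminus)
      also have "\<dots> \<le> e1 * ((Q + 1) * euclid_norm h)"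
        using e1 vn by (intro mult_left_mono) auto
      finally have Mv: "euclid_norm (M *\<^sub>v (dy @\<^sub>v h)) \<le> e1 * ((Q + 1) * euclid_norm h)" .
      \<comment> \<open>Applying \<open>B\<close> to the linearised equation \<open>M (dy, h) \<approx> 0\<close> and solving for \<open>dy\<close>.\<close>
      have parts: "dy @\<^sub>v 0\<^sub>v m \<in> carrier_vec (n + m)" "0\<^sub>v n @\<^sub>v h \<in> carrier_vec (n + m)"
        using dy h by auto
      have "M *\<^sub>v (dy @\<^sub>v h) = M *\<^sub>v (dy @\<^sub>v 0\<^sub>v m) + N *\<^sub>v h"
        unfolding append_vec_eq_add[OF dy h] mult_add_distrib_mat_vec[OF M parts] Nh[OF h] ..
      moreover have "M *\<^sub>v (dy @\<^sub>v 0\<^sub>v m) \<in> carrier_vec n" "N *\<^sub>v h \<in> carrier_vec n"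
        using M N parts h by simp_all
      ultimately have "B *\<^sub>v (M *\<^sub>v (dy @\<^sub>v h)) = dy + B *\<^sub>v (N *\<^sub>v h)"
        using mult_add_distrib_mat_vec[OF B] left[OF dy] by simp
      also have "\<dots> = dy - (- (B * N)) *\<^sub>v h"
      proof -
        have "(- (B * N)) *\<^sub>v h = - (B *\<^sub>v (N *\<^sub>v h))"
          using B N h assoc_mult_mat_vec[OF B N h] by simp
        then show ?thesis
          using B dy by (simp only:) (intro eq_vecI, simp_all)
      qed
      finally have "euclid_norm (dy - (- (B * N)) *\<^sub>v h) \<le> K * euclid_norm (M *\<^sub>v (dy @\<^sub>v h))"
        using K(2)[of "M *\<^sub>v (dy @\<^sub>v h)"] M v by simp
      also have "\<dots> \<le> K * (e1 * ((Q + 1) * euclid_norm h))"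
        using K Mv by (intro mult_left_mono) auto
      also have "\<dots> = e * euclid_norm h"
        using K Q by (simp add: e1_def)
      finally show "euclid_norm (sol (u0 + h) - sol u0 - (- (B * N)) *\<^sub>v h) \<le> e * euclid_norm h"
        by (simp add: dy_def y0_def)
    qed
  qed
  then show ?thesis
    by (rule that)
qed

section \<open>Gradients and the descent lemma\<close>

lemma line_derivative_gradient:
  assumes diff: "vec_differentiable d 1 (\<lambda>x. scalar_vec (f x))"
    and x: "x \<in> carrier_vec d" and h: "h \<in> carrier_vec d"
  shows "((\<lambda>s. f (x + s \<cdot>\<^sub>v h)) has_real_derivative vec_gradient d f (x + t \<cdot>\<^sub>v h) \<bullet> h) (at t)"
proof -
  let ?J = "vec_jacobian d 1 (\<lambda>x. scalar_vec (f x)) (x + t \<cdot>\<^sub>v h)"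
  have "x + t \<cdot>\<^sub>v h \<in> carrier_vec d"
    using x h by simp
  then have J: "has_vec_jacobian d 1 (\<lambda>x. scalar_vec (f x)) (x + t \<cdot>\<^sub>v h) ?J"
    using diff by (intro has_vec_jacobian_vec_jacobian) auto
  then have "?J \<in> carrier_mat 1 d"
    by (simp add: has_vec_jacobian_def)
  then have "(?J *\<^sub>v h) $ 0 = vec_gradient d f (x + t \<cdot>\<^sub>v h) \<bullet> h"
    by (simp add: vec_gradient_def)
  then show ?thesis
    using has_vec_jacobian_line_index[OF J _ x h, of 0] by auto
qed

lemma vec_gradient_carrier:
  assumes diff: "vec_differentiable d 1 (\<lambda>x. scalar_vec (f x))" and x: "x \<in> carrier_vec d"
  shows "vec_gradient d f x \<in> carrier_vec d"
  using has_vec_jacobian_vec_jacobian[OF diff _ x]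
  by (intro carrier_vecI) (auto simp: vec_gradient_def has_vec_jacobian_def)

text \<open>
Along the segment from \<open>x\<close> to \<open>x + s\<close>, the difference of \<open>f\<close> and its quadratic upper model has
  derivative at most zero, by Cauchy--Schwarz and the Lipschitz bound.
\<close>

lemma lipschitz_gradient_descent:
  assumes diff: "vec_differentiable d 1 (\<lambda>x. scalar_vec (f x))"
    and lip: "\<And>x z. x \<in> carrier_vec d \<Longrightarrow> z \<in> carrier_vec d \<Longrightarrow>
      euclid_norm (vec_gradient d f x - vec_gradient d f z) \<le> L * euclid_norm (x - z)"
    and x: "x \<in> carrier_vec d" and s: "s \<in> carrier_vec d"
  shows "f (x + s) \<le> f x + vec_gradient d f x \<bullet> s + L / 2 * (euclid_norm s)\<^sup>2"
proof -
  let ?g = "vec_gradient d f"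
  \<comment> \<open>\<open>psi\<close> decreases on the unit interval, and \<open>psi 1 \<le> psi 0\<close> is the claim.\<close>
  define psi where "psi t = f (x + t \<cdot>\<^sub>v s) - t * (?g x \<bullet> s) - L / 2 * (euclid_norm s)\<^sup>2 * t\<^sup>2" for t
  have "psi 1 \<le> psi 0"
  proof (rule DERIV_nonpos_imp_nonincreasing[where f = psi and a = 0 and b = 1])
    fix t :: real assume t: "0 \<le> t" "t \<le> 1"
    let ?z = "x + t \<cdot>\<^sub>v s"
    have z: "?z \<in> carrier_vec d"
      using x s by simp
    have gz: "?g ?z \<in> carrier_vec d" and gx: "?g x \<in> carrier_vec d"
      using vec_gradient_carrier[OF diff] x z by auto
    have "(psi has_real_derivative (?g ?z \<bullet> s - ?g x \<bullet> s - L / 2 * (euclid_norm s)\<^sup>2 * (2 * t))) (at t)"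
      unfolding psi_def
      by (auto intro!: derivative_eq_intros line_derivative_gradient[OF diff x s])
    moreover have "?g ?z \<bullet> s - ?g x \<bullet> s \<le> L * t * (euclid_norm s)\<^sup>2"
    proof -
      have "?z - x = t \<cdot>\<^sub>v s"
        using x s by (intro eq_vecI) auto
      then have "euclid_norm (?g ?z - ?g x) \<le> L * (t * euclid_norm s)"
        using lip[OF z x] t by (simp add: euclid_norm_smult)
      then have "euclid_norm (?g ?z - ?g x) * euclid_norm s \<le> L * (t * euclid_norm s) * euclid_norm s"
        by (intro mult_right_mono) auto
      moreover have "(?g ?z - ?g x) \<bullet> s \<le> euclid_norm (?g ?z - ?g x) * euclid_norm s"
        using abs_scalar_prod_le[of "?g ?z - ?g x" s] gx s by simp
      ultimately show ?thesis
        using minus_scalar_prod_distrib[OF gz gx s] by (simp add: power2_eq_square mult.assoc)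
    qed
    ultimately show "\<exists>D. (psi has_real_derivative D) (at t) \<and> D \<le> 0"
      by (intro exI conjI) (auto simp: algebra_simps)
  qed simp
  moreover have "x + 1 \<cdot>\<^sub>v s = x + s" "x + 0 \<cdot>\<^sub>v s = x"
    using x s by (auto intro!: eq_vecI)
  ultimately show ?thesis
    by (simp add: psi_def)
qed

section \<open>The reduced problem\<close>

lemma joint_append:
  assumes "y \<in> carrier_vec n" "u \<in> carrier_vec m"
  shows "joint n m f (y @\<^sub>v u) = f y u"
proof -
  have "vec_first (y @\<^sub>v u) n = y" "vec_last (y @\<^sub>v u) m = u"
    using assms by (auto simp: vec_first_def vec_last_def intro!: eq_vecI)
  then show ?thesis
    by (simp add: joint_def)
qed

lemma joint_resid_carrier:
  assumes "ls_setting P"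
  shows "joint (dim_state P) (dim_ctrl P) (resid P)
    \<in> carrier_vec (dim_state P + dim_ctrl P) \<rightarrow> carrier_vec (dim_resid P)"
  using assms by (auto simp: ls_setting_def joint_def)

lemma joint_constr_carrier:
  assumes "ls_setting P"
  shows "joint (dim_state P) (dim_ctrl P) (constr P)
    \<in> carrier_vec (dim_state P + dim_ctrl P) \<rightarrow> carrier_vec (dim_constr P)"
  using assms by (auto simp: ls_setting_def joint_def)

lemma solves_constr_state:
  assumes "regular_constraint P" "u \<in> carrier_vec (dim_ctrl P)"
  shows "solves_constr P (state P u) u"
proof -
  have "\<exists>!y. solves_constr P y u"
    using assms unfolding regular_constraint_def by blast
  then show ?thesis
    unfolding state_def by (rule theI')
qed

lemma solves_constr_unique:
  assumes "regular_constraint P" "u \<in> carrier_vec (dim_ctrl P)" "solves_constr P y u"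
  shows "y = state P u"
  using assms solves_constr_state[OF assms(1,2)] by (auto simp: regular_constraint_def)

text \<open>
The partial Jacobian of the constraint in the state is the joint Jacobian times the padding \<open>y \<mapsto> (y, 0)\<close>, and
  its inverse is the matrix \<open>B\<close> that the implicit function theorem asks for.  Invertibility also forces as many
  constraints as state variables.
\<close>

lemma state_differentiable:
  assumes P: "ls_setting P" and reg: "regular_constraint P" and u: "u \<in> carrier_vec (dim_ctrl P)"
  obtains Z where "has_vec_jacobian (dim_ctrl P) (dim_state P) (state P) u Z"
proof -
  define n m p where "n = dim_state P" and "m = dim_ctrl P" and "p = dim_constr P"
  define F where "F = joint n m (constr P)"
  define y where "y = state P u"
  define M where "M = vec_jacobian (n + m) p F (y @\<^sub>v u)"
  define E where "E = 1\<^sub>m n @\<^sub>r (0\<^sub>m m n :: real mat)"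
  note dims = n_def[symmetric] m_def[symmetric] p_def[symmetric]
  have u: "u \<in> carrier_vec m"
    using u by (simp add: m_def)
  have F: "F \<in> carrier_vec (n + m) \<rightarrow> carrier_vec p"
    using joint_constr_carrier[OF P] by (simp add: dims F_def)
  have C1: "vec_C1 (n + m) p F"
    using reg by (simp add: regular_constraint_def dims F_def vec_C2_imp_C1)
  have Fa: "F (y' @\<^sub>v u') = constr P y' u'" if "y' \<in> carrier_vec n" "u' \<in> carrier_vec m" for y' u'
    using joint_append that by (simp add: F_def)
  have y: "y \<in> carrier_vec n"
    using solves_constr_state[OF reg, of u] u by (simp add: y_def solves_constr_def dims)
  have yu: "y @\<^sub>v u \<in> carrier_vec (n + m)"
    using y u by auto
  have jac: "has_vec_jacobian (n + m) p F (y @\<^sub>v u) M"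
    unfolding M_def using C1 F yu by (intro has_vec_jacobian_vec_jacobian) (auto simp: vec_C1_def)
  then have M: "M \<in> carrier_mat p (n + m)"
    by (simp add: has_vec_jacobian_def)
  have E: "E \<in> carrier_mat (n + m) n"
    unfolding E_def by (rule carrier_append_rows) auto
  have "has_vec_jacobian n (n + m) (\<lambda>y'. y' @\<^sub>v u) y E"
    unfolding E_def using y u
    by (intro has_vec_jacobian_append has_vec_jacobian_id has_vec_jacobian_const) auto
  then have "has_vec_jacobian n p (\<lambda>y'. F (y' @\<^sub>v u)) y (M * E)"
    using has_vec_jacobian_compose[of "\<lambda>y'. y' @\<^sub>v u" n "n + m" F p y E M] F jac y u by auto
  then have "has_vec_jacobian n p (\<lambda>y'. constr P y' u) y (M * E)"
    by (rule has_vec_jacobian_cong[OF _ y]) (simp add: Fa u)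
  moreover have "(\<lambda>y'. constr P y' u) \<in> carrier_vec n \<rightarrow> carrier_vec p"
    using P u by (auto simp: ls_setting_def dims)
  ultimately have A: "constr_jac_state P y u = M * E"
    unfolding constr_jac_state_def dims by (intro vec_jacobian_eq y)
  have "invertible_mat (constr_jac_state P y u)"
    using reg solves_constr_state[OF reg, of u] u
    unfolding regular_constraint_def y_def dims by blast
  then have "invertible_mat (M * E)"
    unfolding A .
  then obtain B where sq: "dim_row (M * E) = dim_col (M * E)"
    and AB: "(M * E) * B = 1\<^sub>m (dim_row (M * E))" and BA: "B * (M * E) = 1\<^sub>m (dim_row B)"
    unfolding invertible_mat_def inverts_mat_def square_mat.simps by auto
  have pn: "p = n"
    using sq M E by simp
  have B: "B \<in> carrier_mat n n"
  proof
    have "dim_col ((M * E) * B) = n" "dim_col (B * (M * E)) = dim_row B"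
      unfolding AB BA using M pn by simp_all
    then show "dim_row B = n" "dim_col B = n"
      using E by simp_all
  qed
  have AB_n: "(M * E) * B = 1\<^sub>m n" and BA_n: "B * (M * E) = 1\<^sub>m n"
    unfolding AB BA using M B pn by simp_all
  have Ev: "E *\<^sub>v v = v @\<^sub>v 0\<^sub>v m" if "v \<in> carrier_vec n" for v
    unfolding E_def using that by (simp add: mat_mult_append[of _ n n _ m] zero_mult_mat_vec)
  have Mv: "M *\<^sub>v (v @\<^sub>v 0\<^sub>v m) = (M * E) *\<^sub>v v" if "v \<in> carrier_vec n" for v
    using assoc_mult_mat_vec[OF M E that] Ev[OF that] by simp
  have ME: "M * E \<in> carrier_mat n n"
    using M E pn by simp
  have "\<exists>Z. has_vec_jacobian m n (state P) u Z"
  proof (rule implicit_function_differentiable[of n m F "state P" u B])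
    show "vec_C1 (n + m) n F" "F \<in> carrier_vec (n + m) \<rightarrow> carrier_vec n"
      using C1 F pn by simp_all
    show "state P u' \<in> carrier_vec n \<and> F (state P u' @\<^sub>v u') = 0\<^sub>v n" if "u' \<in> carrier_vec m" for u'
      using solves_constr_state[OF reg, of u'] that Fa pn by (auto simp: solves_constr_def dims)
    show "y' = state P u'"
      if "u' \<in> carrier_vec m" "y' \<in> carrier_vec n" "F (y' @\<^sub>v u') = 0\<^sub>v n" for u' y'
      using solves_constr_unique[OF reg, of u' y'] that Fa pn by (auto simp: solves_constr_def dims)
    show "B *\<^sub>v (vec_jacobian (n + m) n F (state P u @\<^sub>v u) *\<^sub>v (v @\<^sub>v 0\<^sub>v m)) = v"
      if "v \<in> carrier_vec n" for v
      unfolding M_def[unfolded pn y_def, symmetric] Mv[OF that]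
        assoc_mult_mat_vec[OF B ME that, symmetric] BA_n
      using that by simp
    show "vec_jacobian (n + m) n F (state P u @\<^sub>v u) *\<^sub>v ((B *\<^sub>v v) @\<^sub>v 0\<^sub>v m) = v"
      if "v \<in> carrier_vec n" for v
      unfolding M_def[unfolded pn y_def, symmetric] Mv[OF mult_mat_vec_carrier[OF B that]]
        assoc_mult_mat_vec[OF ME B that, symmetric] AB_n
      using that by simp
  qed (use u B in auto)
  then show ?thesis
    using that by (auto simp: dims)
qed

lemma Rhat_carrier:
  assumes "ls_setting P" "regular_constraint P"
  shows "Rhat P \<in> carrier_vec (dim_ctrl P) \<rightarrow> carrier_vec (dim_resid P)"
  using assms solves_constr_state[OF assms(2)]
  by (auto simp: Rhat_def ls_setting_def solves_constr_def)

lemma has_vec_jacobian_Rhat: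
  assumes P: "ls_setting P" and reg: "regular_constraint P" and u: "u \<in> carrier_vec (dim_ctrl P)"
  shows "has_vec_jacobian (dim_ctrl P) (dim_resid P) (Rhat P) u (Ghat P u)"
proof -
  let ?n = "dim_state P" and ?m = "dim_ctrl P" and ?q = "dim_resid P"
  let ?F = "joint ?n ?m (resid P)"
  have y: "state P u' \<in> carrier_vec ?n" if "u' \<in> carrier_vec ?m" for u'
    using solves_constr_state[OF reg that] by (simp add: solves_constr_def)
  obtain Z where Z: "has_vec_jacobian ?m ?n (state P) u Z"
    using state_differentiable[OF P reg u] by blast
  have inner: "has_vec_jacobian ?m (?n + ?m) (\<lambda>u. state P u @\<^sub>v u) u (Z @\<^sub>r 1\<^sub>m ?m)"
    using y u Z by (intro has_vec_jacobian_append has_vec_jacobian_id) auto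
  obtain A where "has_vec_jacobian (?n + ?m) ?q ?F (state P u @\<^sub>v u) A"
    using P append_carrier_vec[OF y[OF u] u] unfolding ls_setting_def vec_differentiable_def by blast
  then have "has_vec_jacobian ?m ?q (\<lambda>u. ?F (state P u @\<^sub>v u)) u (A * (Z @\<^sub>r 1\<^sub>m ?m))"
    using has_vec_jacobian_compose[OF _ joint_resid_carrier[OF P] u inner] y by auto
  then have "has_vec_jacobian ?m ?q (Rhat P) u (A * (Z @\<^sub>r 1\<^sub>m ?m))"
    by (rule has_vec_jacobian_cong[OF _ u]) (simp add: joint_append y Rhat_def)
  then show ?thesis
    using vec_jacobian_eq[OF _ Rhat_carrier[OF P reg] u] by (simp add: Ghat_def)
qed

lemma Jhat_eq: "Jhat P u = (euclid_norm (Rhat P u))\<^sup>2 / 2"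
  by (simp add: Jhat_def ls_obj_def Rhat_def)

text \<open>
Both sides are compared through the derivatives of the reduced objective along the coordinate
  directions.
\<close>

lemma vec_gradient_Jhat:
  assumes P: "ls_setting P" and reg: "regular_constraint P" and u: "u \<in> carrier_vec (dim_ctrl P)"
    and diff: "vec_differentiable (dim_ctrl P) 1 (\<lambda>u. scalar_vec (Jhat P u))"
  shows "vec_gradient (dim_ctrl P) (Jhat P) u = transpose_mat (Ghat P u) *\<^sub>v Rhat P u"
proof (rule eq_vecI)
  let ?m = "dim_ctrl P" and ?q = "dim_resid P"
  have jac: "has_vec_jacobian ?m ?q (Rhat P) u (Ghat P u)"
    using has_vec_jacobian_Rhat[OF P reg u] .
  then have G: "Ghat P u \<in> carrier_mat ?q ?m"
    by (simp add: has_vec_jacobian_def)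
  note R = Rhat_carrier[OF P reg]
  show "dim_vec (vec_gradient ?m (Jhat P) u) = dim_vec (transpose_mat (Ghat P u) *\<^sub>v Rhat P u)"
    using vec_gradient_carrier[OF diff u] G by simp
  fix j assume "j < dim_vec (transpose_mat (Ghat P u) *\<^sub>v Rhat P u)"
  then have j: "j < ?m"
    using G by simp
  let ?h = "unit_vec ?m j :: real vec"
  have u0: "u + 0 \<cdot>\<^sub>v ?h = u"
    using u by (intro eq_vecI) auto
  have Ru: "Rhat P u \<in> carrier_vec ?q"
    using R u by auto
  have sumsq: "Jhat P z = (\<Sum>i<?q. (Rhat P z $ i)\<^sup>2) / 2" if "z \<in> carrier_vec ?m" for z
    unfolding Jhat_eq euclid_norm_squared scalar_prod_def
    using funcset_mem[OF R that] by (simp add: atLeast0LessThan power2_eq_square)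
  have "((\<lambda>s. (\<Sum>i<?q. (Rhat P (u + s \<cdot>\<^sub>v ?h) $ i)\<^sup>2) / 2) has_real_derivative
      (\<Sum>i<?q. 2 * ((Ghat P u *\<^sub>v ?h) $ i * Rhat P (u + 0 \<cdot>\<^sub>v ?h) $ i)) / 2) (at 0)"
    using has_vec_jacobian_line_index[of ?m ?q "Rhat P" u 0 ?h "Ghat P u"] jac R u
    by (intro DERIV_cdivide DERIV_sum) (auto simp: u0 intro!: derivative_eq_intros)
  then have "((\<lambda>s. Jhat P (u + s \<cdot>\<^sub>v ?h)) has_real_derivative
      (\<Sum>i<?q. 2 * ((Ghat P u *\<^sub>v ?h) $ i * Rhat P u $ i)) / 2) (at 0)"
    using u by (simp add: sumsq u0)
  moreover have "((\<lambda>s. Jhat P (u + s \<cdot>\<^sub>v ?h)) has_real_derivative vec_gradient ?m (Jhat P) u \<bullet> ?h) (at 0)"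
    using line_derivative_gradient[OF diff u, of ?h 0] by (simp add: u0)
  ultimately have "vec_gradient ?m (Jhat P) u \<bullet> ?h = (\<Sum>i<?q. 2 * ((Ghat P u *\<^sub>v ?h) $ i * Rhat P u $ i)) / 2"
    by (rule DERIV_unique[rotated])
  also have "\<dots> = Rhat P u \<bullet> (Ghat P u *\<^sub>v ?h)"
    using G by (simp add: scalar_prod_def atLeast0LessThan sum_distrib_left[symmetric] mult.commute)
  also have "\<dots> = (transpose_mat (Ghat P u) *\<^sub>v Rhat P u) \<bullet> ?h"
    using transpose_vec_mult_scalar[OF G _ Ru, of ?h] by simp
  finally show "vec_gradient ?m (Jhat P) u $ j = (transpose_mat (Ghat P u) *\<^sub>v Rhat P u) $ j"
    using j by simp
qed

section \<open>Counting indices\<close>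

text \<open>
Finiteness of \<open>S\<close> has to be concluded, not assumed: every finite subset of \<open>S\<close> lies in the initial
  segment that ends at its maximum.
\<close>

lemma finite_card_le_if_initial_segments_le:
  fixes S :: "nat set"
  assumes le: "\<And>k. k \<in> S \<Longrightarrow> card {j \<in> S. j \<le> k} \<le> N"
  shows "finite S \<and> card S \<le> N"
proof (rule finite_if_finite_subsets_card_bdd)
  fix T assume T: "T \<subseteq> S" "finite T"
  show "card T \<le> N"
  proof (cases "T = {}")
    case False
    then have "Max T \<in> S"
      using T Max_in[of T] by blast
    moreover have "T \<subseteq> {j \<in> S. j \<le> Max T}"
      using T by auto
    moreover have "finite {j \<in> S. j \<le> Max T}"
      by simp
    ultimately show ?thesis
      using le card_mono le_trans by meson
  qed simp
qed

text \<open>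
After \<open>N\<close> indices of \<open>S\<close> the value has been multiplied by at most \<open>exp (- q * N)\<close>, since
  \<open>1 - q \<le> exp (- q)\<close>, yet it exceeds \<open>c\<close> at the next one.  The last index itself is not controlled
  in this way, whence the summand 1.
\<close>

lemma geometric_decrease_card_le:
  fixes f :: "nat \<Rightarrow> real"
  assumes q: "q > 0" and c: "c > 0"
    and mono: "\<And>k. f (Suc k) \<le> f k" and nonneg: "\<And>k. 0 \<le> f k"
    and decr: "\<And>k. k \<in> S \<Longrightarrow> f (Suc k) \<le> (1 - q) * f k"
    and above: "\<And>k. k \<in> S \<Longrightarrow> c < f k"
  shows "finite S" and "real (card S) \<le> 1 + \<bar>ln (f 0 / c)\<bar> / q"
proof -
  have geo: "f k \<le> exp (- q * card {j \<in> S. j < k}) * f 0" for k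
  proof (induction k)
    case (Suc k)
    show ?case
    proof (cases "k \<in> S")
      case True
      then have "{j \<in> S. j < Suc k} = insert k {j \<in> S. j < k}"
        by (auto simp: less_Suc_eq)
      then have card: "real (card {j \<in> S. j < Suc k}) = card {j \<in> S. j < k} + 1"
        by simp
      have "f (Suc k) \<le> (1 - q) * f k"
        using decr[OF True] .
      also have "\<dots> \<le> exp (- q) * f k"
        using exp_ge_add_one_self[of "- q"] nonneg by (intro mult_right_mono) auto
      also have "\<dots> \<le> exp (- q) * (exp (- q * card {j \<in> S. j < k}) * f 0)"
        using Suc.IH by (intro mult_left_mono) auto
      also have "\<dots> = exp (- q * card {j \<in> S. j < Suc k}) * f 0"
        unfolding card by (simp add: algebra_simps exp_add exp_diff exp_minus field_simps)
      finally show ?thesis .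
    next
      case False
      then have "{j \<in> S. j < Suc k} = {j \<in> S. j < k}"
        by (auto simp: less_Suc_eq)
      then show ?thesis
        using mono[of k] Suc.IH by simp
    qed
  qed simp
  have seg: "real (card {j \<in> S. j \<le> k}) \<le> 1 + \<bar>ln (f 0 / c)\<bar> / q" if k: "k \<in> S" for k
  proof -
    define N where "N = card {j \<in> S. j < k}"
    have "{j \<in> S. j \<le> k} = insert k {j \<in> S. j < k}"
      using k by auto
    then have card: "card {j \<in> S. j \<le> k} = Suc N"
      by (simp add: N_def)
    have "c < exp (- q * N) * f 0"
      using above[OF k] geo[of k] by (simp add: N_def)
    then have "exp (q * N) < f 0 / c"
      using c by (simp add: exp_minus field_simps)
    moreover from this have "0 < f 0 / c"
      using exp_gt_zero less_trans by blast
    ultimately have "exp (q * N) < exp (ln (f 0 / c))"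
      by (simp only: exp_ln)
    then have "q * N < ln (f 0 / c)"
      by (simp only: exp_less_cancel_iff)
    then have "real N \<le> \<bar>ln (f 0 / c)\<bar> / q"
      using q by (simp add: pos_le_divide_eq mult.commute)
    then show ?thesis
      by (simp add: card)
  qed
  have "card {j \<in> S. j \<le> k} \<le> nat \<lfloor>1 + \<bar>ln (f 0 / c)\<bar> / q\<rfloor>" if "k \<in> S" for k
    using seg[OF that] by (rule le_nat_floor)
  then have fin: "finite S \<and> card S \<le> nat \<lfloor>1 + \<bar>ln (f 0 / c)\<bar> / q\<rfloor>"
    by (rule finite_card_le_if_initial_segments_le)
  then show "finite S"
    by blast
  have "0 \<le> 1 + \<bar>ln (f 0 / c)\<bar> / q"
    using q by simp
  then show "real (card S) \<le> 1 + \<bar>ln (f 0 / c)\<bar> / q"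
    using fin of_nat_floor[of "1 + \<bar>ln (f 0 / c)\<bar> / q"] of_nat_mono[of "card S"] order_trans by blast
qed

lemma card_le_if_followed_within:
  fixes N S :: "nat set"
  assumes S: "finite S" and near: "\<And>k. k \<in> N \<Longrightarrow> \<exists>j\<in>S. k \<le> j \<and> j \<le> k + K"
  shows "finite N" and "card N \<le> (K + 1) * card S"
proof -
  have sub: "N \<subseteq> (\<Union>j\<in>S. {j - K..j})"
    using near by fastforce
  have fin: "finite (\<Union>j\<in>S. {j - K..j})"
    using S by simp
  show "finite N"
    using sub fin by (rule finite_subset)
  have "card N \<le> card (\<Union>j\<in>S. {j - K..j})"
    using fin sub by (rule card_mono)
  also have "\<dots> \<le> (\<Sum>j\<in>S. card {j - K..j})"
    using S by (rule card_UN_le)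
  also have "\<dots> \<le> (\<Sum>j\<in>S. K + 1)"
    by (intro sum_mono) auto
  finally show "card N \<le> (K + 1) * card S"
    by (simp add: mult.commute)
qed

section \<open>Exact steps of the regularization method\<close>

locale exact_regularized_run =
  fixes P :: ls_problem and r :: method_data and L M_H eta gamma0 gamma_min :: real
  assumes L: "L > 0" and M_H: "M_H > 0" and eta: "0 < eta" "eta < 1"
    and gamma: "gamma0 > 0" "0 < gamma_min" "gamma_min \<le> gamma0"
    and setting: "ls_setting P" and constraint: "regular_constraint P"
    and lipschitz: "lipschitz_gradient P L"
    and run: "method_run P eta gamma0 gamma_min r" and exact: "exact_steps P r"
    and hess_le: "\<And>k. spectral_norm (hess r k) \<le> M_H"
    and hess_psd: "\<And>k. positive_semidefinite_mat (dim_ctrl P) (hess r k)"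
begin

abbreviation "n \<equiv> dim_ctrl P"

definition predicted :: "nat \<Rightarrow> real" where
  "predicted k = model P r k (0\<^sub>v n) - model P r k (step r k)"

definition reg_max :: real where
  "reg_max = max gamma0 (2 * L)"

lemma hess_carrier: "hess r k \<in> carrier_mat n n"
  and step_carrier: "step r k \<in> carrier_vec n"
  using run by (simp_all add: method_run_def)

lemma run_step:
  "if grad P r k = 0\<^sub>v n
   then ctrl r (Suc k) = ctrl r k \<and> reg r (Suc k) \<in> {max (reg r k / 2) gamma_min, 2 * reg r k}
   else if eta \<le> ratio P r k
   then ctrl r (Suc k) = ctrl r k + step r k \<and> reg r (Suc k) = max (reg r k / 2) gamma_min
   else ctrl r (Suc k) = ctrl r k \<and> reg r (Suc k) = 2 * reg r k"
  using run unfolding method_run_def by blast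

lemma run_stationary:
  assumes "grad P r k = 0\<^sub>v n"
  shows "ctrl r (Suc k) = ctrl r k" "reg r (Suc k) \<in> {max (reg r k / 2) gamma_min, 2 * reg r k}"
  using run_step[of k] unfolding if_P[OF assms] by blast+

lemma run_accepted:
  assumes "grad P r k \<noteq> 0\<^sub>v n" "eta \<le> ratio P r k"
  shows "ctrl r (Suc k) = ctrl r k + step r k" "reg r (Suc k) = max (reg r k / 2) gamma_min"
  using run_step[of k] unfolding if_not_P[OF assms(1)] if_P[OF assms(2)] by blast+

lemma run_rejected:
  assumes "grad P r k \<noteq> 0\<^sub>v n" "\<not> eta \<le> ratio P r k"
  shows "ctrl r (Suc k) = ctrl r k" "reg r (Suc k) = 2 * reg r k"
  using run_step[of k] unfolding if_not_P[OF assms(1)] if_not_P[OF assms(2)] by blast+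

lemma ctrl_carrier: "ctrl r k \<in> carrier_vec n"
proof (induction k)
  case 0
  then show ?case
    using run by (simp add: method_run_def)
next
  case (Suc k)
  then show ?case
    using run_stationary(1)[of k] run_accepted(1)[of k] run_rejected(1)[of k] step_carrier[of k]
    by (metis add_carrier_vec)
qed

lemma reg_ge: "gamma_min \<le> reg r k"
proof (induction k)
  case 0
  then show ?case
    using run gamma by (simp add: method_run_def)
next
  case (Suc k)
  have "reg r (Suc k) \<in> {max (reg r k / 2) gamma_min, 2 * reg r k}"
    using run_stationary(2)[of k] run_accepted(2)[of k] run_rejected(2)[of k] by blast
  then show ?case
    using Suc gamma by auto
qed

lemma Jhat_differentiable: "vec_differentiable n 1 (\<lambda>u. scalar_vec (Jhat P u))"
  using lipschitz by (simp add: lipschitz_gradient_def vec_C1_def)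

lemma grad_eq: "grad P r k = vec_gradient n (Jhat P) (ctrl r k)"
  unfolding grad_def by (rule vec_gradient_Jhat[OF setting constraint ctrl_carrier Jhat_differentiable, symmetric])

lemma grad_carrier: "grad P r k \<in> carrier_vec n"
  unfolding grad_eq by (rule vec_gradient_carrier[OF Jhat_differentiable ctrl_carrier])

lemma Jhat_step_le:
  "Jhat P (ctrl r k + step r k)
     \<le> Jhat P (ctrl r k) + grad P r k \<bullet> step r k + L / 2 * (euclid_norm (step r k))\<^sup>2"
  unfolding grad_eq using lipschitz
  by (intro lipschitz_gradient_descent Jhat_differentiable ctrl_carrier step_carrier)
    (auto simp: lipschitz_gradient_def)

lemma model_eq:
  assumes s: "s \<in> carrier_vec n"
  shows "model P r k s = Jhat P (ctrl r k) + grad P r k \<bullet> s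
    + (s \<bullet> (hess r k *\<^sub>v s) + reg r k * (euclid_norm s)\<^sup>2) / 2"
proof -
  have H: "hess r k *\<^sub>v s \<in> carrier_vec n"
    by (rule mult_mat_vec_carrier[OF hess_carrier s])
  have "(reg r k \<cdot>\<^sub>m 1\<^sub>m n) *\<^sub>v s = reg r k \<cdot>\<^sub>v s"
    using s by (intro eq_vecI) auto
  then have "(hess r k + reg r k \<cdot>\<^sub>m 1\<^sub>m n) *\<^sub>v s = hess r k *\<^sub>v s + reg r k \<cdot>\<^sub>v s"
    using add_mult_distrib_mat_vec[OF hess_carrier _ s, of "reg r k \<cdot>\<^sub>m 1\<^sub>m n" k] by simp
  then have "s \<bullet> ((hess r k + reg r k \<cdot>\<^sub>m 1\<^sub>m n) *\<^sub>v s) = s \<bullet> (hess r k *\<^sub>v s) + reg r k * (euclid_norm s)\<^sup>2"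
    using scalar_prod_add_distrib[OF s H, of "reg r k \<cdot>\<^sub>v s"] s by (simp add: euclid_norm_squared)
  then show ?thesis
    by (simp add: model_def Jhat_eq)
qed

lemma model_zero: "model P r k (0\<^sub>v n) = Jhat P (ctrl r k)"
  using model_eq[of "0\<^sub>v n" k] grad_carrier[of k] mult_mat_vec_carrier[OF hess_carrier[of k], of "0\<^sub>v n"]
  by simp

text \<open>
The exact minimizer is compared with \<open>- g / (M_H + \<gamma>)\<close>, the minimizer along the steepest descent direction of
  the quadratic model in which the curvature is replaced by its upper bound \<open>M_H + \<gamma>\<close>.
\<close>

lemma predicted_ge: "(euclid_norm (grad P r k))\<^sup>2 / (2 * (M_H + reg r k)) \<le> predicted k"
proof -
  let ?g = "grad P r k" and ?H = "hess r k"
  define b where "b = M_H + reg r k"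
  define s where "s = (- 1 / b) \<cdot>\<^sub>v ?g"
  have b: "b > 0"
    using M_H gamma reg_ge[of k] by (simp add: b_def)
  note g = grad_carrier[of k]
  have Hg: "?H *\<^sub>v ?g \<in> carrier_vec n"
    by (rule mult_mat_vec_carrier[OF hess_carrier g])
  have "?g \<bullet> (?H *\<^sub>v ?g) \<le> euclid_norm ?g * euclid_norm (?H *\<^sub>v ?g)"
    using abs_scalar_prod_le[of ?g "?H *\<^sub>v ?g"] g hess_carrier[of k] by simp
  also have "\<dots> \<le> euclid_norm ?g * (M_H * euclid_norm ?g)"
  proof (rule mult_left_mono)
    have "spectral_norm ?H * euclid_norm ?g \<le> M_H * euclid_norm ?g"
      using hess_le by (intro mult_right_mono) auto
    then show "euclid_norm (?H *\<^sub>v ?g) \<le> M_H * euclid_norm ?g"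
      using euclid_norm_mult_mat_vec_le_spectral_norm[OF hess_carrier g] by (rule order_trans[rotated])
  qed simp
  finally have "?g \<bullet> (?H *\<^sub>v ?g) + reg r k * (euclid_norm ?g)\<^sup>2 \<le> b * (euclid_norm ?g)\<^sup>2"
    by (simp add: b_def power2_eq_square algebra_simps)
  then have curv: "(?g \<bullet> (?H *\<^sub>v ?g) + reg r k * (euclid_norm ?g)\<^sup>2) / b\<^sup>2 \<le> b * (euclid_norm ?g)\<^sup>2 / b\<^sup>2"
    by (intro divide_right_mono) auto
  have s: "s \<in> carrier_vec n"
    using g by (simp add: s_def)
  have "?H *\<^sub>v s = (- 1 / b) \<cdot>\<^sub>v (?H *\<^sub>v ?g)"
    unfolding s_def by (rule mult_mat_vec[OF hess_carrier g])
  then have sHs: "s \<bullet> (?H *\<^sub>v s) = (?g \<bullet> (?H *\<^sub>v ?g)) / b\<^sup>2"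
    unfolding s_def using g Hg by (simp add: power2_eq_square)
  have "(euclid_norm s)\<^sup>2 = (euclid_norm ?g)\<^sup>2 / b\<^sup>2"
    using b by (simp add: s_def euclid_norm_smult power_divide)
  then have "model P r k s = Jhat P (ctrl r k) - (euclid_norm ?g)\<^sup>2 / b
      + (?g \<bullet> (?H *\<^sub>v ?g) + reg r k * (euclid_norm ?g)\<^sup>2) / b\<^sup>2 / 2"
    using g unfolding model_eq[OF s] sHs by (simp add: s_def euclid_norm_squared add_divide_distrib)
  also have "\<dots> \<le> Jhat P (ctrl r k) - (euclid_norm ?g)\<^sup>2 / b + b * (euclid_norm ?g)\<^sup>2 / b\<^sup>2 / 2"
    by (intro add_left_mono divide_right_mono curv) simp
  also have "\<dots> = Jhat P (ctrl r k) - (euclid_norm ?g)\<^sup>2 / (2 * b)"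
    using b by (simp add: power2_eq_square field_simps)
  finally have "model P r k s \<le> Jhat P (ctrl r k) - (euclid_norm ?g)\<^sup>2 / (2 * b)" .
  moreover have "model P r k (step r k) \<le> model P r k s"
    using exact s by (simp add: exact_steps_def)
  ultimately show ?thesis
    by (simp add: predicted_def model_zero b_def)
qed

lemma euclid_norm_grad_pos: "grad P r k \<noteq> 0\<^sub>v n \<Longrightarrow> euclid_norm (grad P r k) > 0"
  using euclid_norm_eq_0_iff[OF grad_carrier, of k] euclid_norm_nonneg[of "grad P r k"] by linarith

lemma predicted_pos:
  assumes "grad P r k \<noteq> 0\<^sub>v n"
  shows "predicted k > 0"
proof -
  have "(euclid_norm (grad P r k))\<^sup>2 / (2 * (M_H + reg r k)) > 0"
    using euclid_norm_grad_pos[OF assms] M_H gamma reg_ge[of k] by simp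
  then show ?thesis
    using predicted_ge[of k] by linarith
qed

text \<open>
The linear terms of the model and of the descent lemma agree, so the comparison reduces to that of
  \<open>L\<close> with the curvature of the model, which is at least \<open>\<gamma>\<close> because the matrix is positive semidefinite.
\<close>

lemma predicted_le_reduction:
  assumes "L \<le> reg r k"
  shows "predicted k \<le> Jhat P (ctrl r k) - Jhat P (ctrl r k + step r k)"
proof -
  let ?s = "step r k"
  have "0 \<le> ?s \<bullet> (hess r k *\<^sub>v ?s)"
    using hess_psd[of k] step_carrier[of k] by (simp add: positive_semidefinite_mat_def)
  moreover have "L * (euclid_norm ?s)\<^sup>2 \<le> reg r k * (euclid_norm ?s)\<^sup>2"
    using assms by (intro mult_right_mono) auto
  ultimately show ?thesis
    unfolding predicted_def model_zero model_eq[OF step_carrier] using Jhat_step_le[of k]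
    by (simp add: field_simps)
qed

lemma ratio_eq: "ratio P r k = (Jhat P (ctrl r k) - Jhat P (ctrl r k + step r k)) / predicted k"
  by (simp add: ratio_def predicted_def)

text \<open>
The reduction ratio is then at least 1.
\<close>

lemma accepted_if_reg_large:
  assumes "grad P r k \<noteq> 0\<^sub>v n" "L \<le> reg r k"
  shows "eta \<le> ratio P r k"
proof -
  have "1 \<le> ratio P r k"
    unfolding ratio_eq using predicted_pos[OF assms(1)] predicted_le_reduction[OF assms(2)] by simp
  then show ?thesis
    using eta by linarith
qed

text \<open>
Success is defined by a change of the control; a vanishing step would predict no decrease.
\<close>

lemma step_nonzero:
  assumes "grad P r k \<noteq> 0\<^sub>v n"
  shows "ctrl r k + step r k \<noteq> ctrl r k"
proof
  assume eq: "ctrl r k + step r k = ctrl r k"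
  have "step r k = 0\<^sub>v n"
  proof (rule eq_vecI)
    fix i assume "i < dim_vec (0\<^sub>v n :: real vec)"
    moreover have "(ctrl r k + step r k) $ i = ctrl r k $ i"
      using eq by simp
    ultimately show "step r k $ i = 0\<^sub>v n $ i"
      using step_carrier[of k] by simp
  qed (use step_carrier[of k] in simp)
  then have "predicted k = 0"
    by (simp add: predicted_def)
  then show False
    using predicted_pos[OF assms] by simp
qed

lemma successful_iff:
  assumes "grad P r k \<noteq> 0\<^sub>v n"
  shows "successful r k \<longleftrightarrow> eta \<le> ratio P r k"
  using run_accepted(1)[OF assms] run_rejected(1)[OF assms] step_nonzero[OF assms]
  by (auto simp: successful_def)

text \<open>
A rejection happens only below \<open>L\<close>, so doubling cannot pass \<open>2 * L\<close>.  At a stationary control the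
  parameter may double forever, hence the hypothesis; a stationary control is never left, so all iterations before a
  nonstationary one are nonstationary too.
\<close>

lemma reg_le:
  "grad P r k \<noteq> 0\<^sub>v n \<Longrightarrow> reg r k \<le> reg_max"
proof (induction k)
  case 0
  then show ?case
    using run by (simp add: method_run_def reg_max_def)
next
  case (Suc k)
  have g: "grad P r k \<noteq> 0\<^sub>v n"
    using Suc.prems run_stationary(1)[of k] by (auto simp: grad_def)
  show ?case
  proof (cases "eta \<le> ratio P r k")
    case True
    then show ?thesis
      using run_accepted(2)[OF g True] Suc.IH[OF g] gamma L reg_ge[of k] by (auto simp: reg_max_def)
  next
    case False
    then have "reg r k < L"
      using accepted_if_reg_large[OF g] by force
    then show ?thesis
      using run_rejected(2)[OF g False] by (simp add: reg_max_def)
  qed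
qed

lemma Jhat_decrease:
  assumes g: "grad P r k \<noteq> 0\<^sub>v n" and acc: "eta \<le> ratio P r k"
  shows "Jhat P (ctrl r (Suc k))
    \<le> Jhat P (ctrl r k) - eta * (euclid_norm (grad P r k))\<^sup>2 / (2 * (M_H + reg_max))"
proof -
  have pos: "M_H + reg r k > 0"
    using M_H gamma reg_ge[of k] by simp
  have "(euclid_norm (grad P r k))\<^sup>2 / (2 * (M_H + reg_max))
      \<le> (euclid_norm (grad P r k))\<^sup>2 / (2 * (M_H + reg r k))"
    using reg_le[OF g] pos by (intro divide_left_mono) auto
  then have "eta * ((euclid_norm (grad P r k))\<^sup>2 / (2 * (M_H + reg_max))) \<le> eta * predicted k"
    using eta predicted_ge[of k] by (intro mult_left_mono) auto
  also have "\<dots> \<le> Jhat P (ctrl r k) - Jhat P (ctrl r (Suc k))"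
    using acc predicted_pos[OF g] unfolding ratio_eq run_accepted(1)[OF g acc]
    by (simp add: pos_le_divide_eq)
  finally show ?thesis
    by simp
qed

lemma Jhat_antimono: "Jhat P (ctrl r (Suc k)) \<le> Jhat P (ctrl r k)"
proof (cases "grad P r k \<noteq> 0\<^sub>v n \<and> eta \<le> ratio P r k")
  case True
  then have "Jhat P (ctrl r (Suc k))
      \<le> Jhat P (ctrl r k) - eta * (euclid_norm (grad P r k))\<^sup>2 / (2 * (M_H + reg_max))"
    using Jhat_decrease by blast
  moreover have "0 \<le> eta * (euclid_norm (grad P r k))\<^sup>2 / (2 * (M_H + reg_max))"
    using eta M_H gamma by (intro divide_nonneg_nonneg) (auto simp: reg_max_def)
  ultimately show ?thesis
    by linarith
next
  case False
  then have "ctrl r (Suc k) = ctrl r k"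
    using run_stationary(1)[of k] run_rejected(1)[of k] by blast
  then show ?thesis
    by simp
qed

section \<open>Iterations and system solves\<close>

text \<open>
The reduced objective is half the squared norm of the residual, so a large quotient in the stopping test
  bounds the squared gradient below by a multiple of the objective.  Such an inequality is what turns sufficient
  decrease into geometric decrease.
\<close>

lemma counted_imp:
  assumes k: "k \<in> counted_iters P r eps_g eps_R" and eps: "eps_g > 0" "eps_R > 0"
  shows "eps_R\<^sup>2 / 2 < Jhat P (ctrl r k)"
    and "2 * eps_g\<^sup>2 * Jhat P (ctrl r k) \<le> (euclid_norm (grad P r k))\<^sup>2"
    and "grad P r k \<noteq> 0\<^sub>v n"
proof -
  let ?R = "euclid_norm (Rhat P (ctrl r k))" and ?g = "euclid_norm (grad P r k)"
  have R: "eps_R < ?R" and quot: "eps_g < ?g / ?R"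
    using k by (auto simp: counted_iters_def approx_optimal_def grad_def)
  have g: "eps_g * ?R < ?g"
    using quot R eps by (simp add: pos_less_divide_eq)
  then have "(eps_g * ?R)\<^sup>2 \<le> ?g\<^sup>2"
    using eps by (intro power_mono) auto
  then show "2 * eps_g\<^sup>2 * Jhat P (ctrl r k) \<le> ?g\<^sup>2"
    by (simp add: Jhat_eq power_mult_distrib)
  have "eps_R\<^sup>2 < ?R\<^sup>2"
    using R eps by (intro power_strict_mono) auto
  then show "eps_R\<^sup>2 / 2 < Jhat P (ctrl r k)"
    by (simp add: Jhat_eq)
  have "0 < eps_g * ?R"
    using eps R by simp
  then show "grad P r k \<noteq> 0\<^sub>v n"
    using g by auto
qed

lemma successful_decrease:
  assumes k: "k \<in> succ_iters P r eps_g eps_R" and eps: "eps_g > 0" "eps_R > 0"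
  shows "Jhat P (ctrl r (Suc k)) \<le> (1 - eta / (M_H + reg_max) * eps_g\<^sup>2) * Jhat P (ctrl r k)"
proof -
  have counted: "k \<in> counted_iters P r eps_g eps_R"
    using k by (simp add: succ_iters_def)
  note c = counted_imp[OF counted eps]
  have acc: "eta \<le> ratio P r k"
    using k successful_iff[OF c(3)] by (simp add: succ_iters_def)
  have pos: "M_H + reg_max > 0"
    using M_H gamma by (simp add: reg_max_def)
  have "eta / (M_H + reg_max) * eps_g\<^sup>2 * Jhat P (ctrl r k)
      = eta * (2 * eps_g\<^sup>2 * Jhat P (ctrl r k)) / (2 * (M_H + reg_max))"
    using pos by (simp add: field_simps)
  also have "\<dots> \<le> eta * (euclid_norm (grad P r k))\<^sup>2 / (2 * (M_H + reg_max))"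
    using c(2) eta pos by (intro divide_right_mono mult_left_mono) auto
  finally show ?thesis
    using Jhat_decrease[OF c(3) acc] by (simp add: algebra_simps)
qed

text \<open>
As long as iterations are unsuccessful, the control is kept (so all of them are counted) and the
  regularization parameter, at least \<open>gamma_min\<close> at the start, doubles; it reaches \<open>L\<close> after \<open>K\<close> doublings, which
  forces acceptance.
\<close>

lemma success_within:
  assumes k: "k \<in> counted_iters P r eps_g eps_R" and eps: "eps_g > 0" "eps_R > 0"
    and K: "L \<le> 2 ^ K * gamma_min"
  obtains j where "j \<in> succ_iters P r eps_g eps_R" "k \<le> j" "j \<le> k + K"
proof -
  note g = counted_imp(3)[OF k eps]
  have same: "ctrl r (k + i) = ctrl r k \<and> reg r (k + i) = 2 ^ i * reg r k"
    if "\<And>i'. i' < i \<Longrightarrow> \<not> successful r (k + i')" for i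
    using that
  proof (induction i)
    case (Suc i)
    have ih: "ctrl r (k + i) = ctrl r k" "reg r (k + i) = 2 ^ i * reg r k"
      using Suc by auto
    have gi: "grad P r (k + i) \<noteq> 0\<^sub>v n"
      using g ih(1) by (simp add: grad_def)
    have "\<not> eta \<le> ratio P r (k + i)"
      using Suc.prems successful_iff[OF gi] by auto
    then show ?case
      using run_rejected[OF gi] ih by simp
  qed simp
  have "\<exists>i\<le>K. successful r (k + i)"
  proof (rule ccontr)
    assume "\<not> ?thesis"
    then have no: "\<not> successful r (k + i)" if "i \<le> K" for i
      using that by blast
    have eq: "ctrl r (k + K) = ctrl r k" "reg r (k + K) = 2 ^ K * reg r k"
      using same[of K] no by auto
    have gK: "grad P r (k + K) \<noteq> 0\<^sub>v n"
      using g eq(1) by (simp add: grad_def)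
    have "2 ^ K * gamma_min \<le> 2 ^ K * reg r k"
      using reg_ge by (intro mult_left_mono) auto
    with K have "L \<le> reg r (k + K)"
      unfolding eq(2) by (rule order_trans)
    then show False
      using accepted_if_reg_large[OF gK] successful_iff[OF gK] no[of K] by simp
  qed
  then obtain i where i: "i \<le> K" "successful r (k + i)" "\<And>i'. i' < i \<Longrightarrow> \<not> successful r (k + i')"
    using exists_least_iff[of "\<lambda>i. i \<le> K \<and> successful r (k + i)"] by fastforce
  have "ctrl r (k + i) = ctrl r k"
    using same i(3) by blast
  then have "k + i \<in> succ_iters P r eps_g eps_R"
    using k i(2) by (simp add: succ_iters_def counted_iters_def)
  with i(1) show ?thesis
    by (intro that) auto
qed

text \<open>
The requirement \<open>eps_R \<le> exp (- 1)\<close> makes the logarithm at least 1, so that it absorbs additive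
  constants.
\<close>

lemma iteration_bounds:
  assumes eps: "0 < eps_g" "eps_g < 1" "0 < eps_R" "eps_R \<le> exp (- 1)"
    and K: "L \<le> 2 ^ K * gamma_min"
    and C: "C = 1 + (real K + 1) * (1 + (\<bar>ln (2 * Jhat P (ctrl r 0))\<bar> + 2) * (M_H + reg_max) / eta)"
  defines "N \<equiv> counted_iters P r eps_g eps_R" and "S \<equiv> succ_iters P r eps_g eps_R"
  shows "finite N" "card S \<le> card N" "real (1 + card N) \<le> C * ln (1 / eps_R) * (1 / eps_g\<^sup>2)"
proof -
  define q where "q = eta / (M_H + reg_max) * eps_g\<^sup>2"
  define D where "D = (\<bar>ln (2 * Jhat P (ctrl r 0))\<bar> + 2) * (M_H + reg_max) / eta"
  define l w where "l = ln (1 / eps_R)" and "w = 1 / eps_g\<^sup>2"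
  have pos: "M_H + reg_max > 0"
    using M_H gamma by (simp add: reg_max_def)
  have q: "q > 0"
    using eta pos eps by (simp add: q_def)
  have D: "D \<ge> 0"
    unfolding D_def using pos eta by (intro divide_nonneg_pos mult_nonneg_nonneg) auto
  have "ln eps_R \<le> ln (exp (- 1))"
    using eps by (subst ln_le_cancel_iff) auto
  then have l: "l \<ge> 1"
    using eps by (simp add: l_def ln_div)
  have "eps_g\<^sup>2 \<le> 1"
    using eps by (intro power_le_one) auto
  then have w: "w \<ge> 1"
    using eps by (simp add: w_def)
  have lw: "1 \<le> l * w"
    using mult_mono[OF l w] l by simp
  have counted: "eps_R\<^sup>2 / 2 < Jhat P (ctrl r k)" if "k \<in> S" for k
    using counted_imp(1)[of k eps_g eps_R] eps that by (simp add: S_def succ_iters_def)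
  have "eps_R\<^sup>2 / 2 > 0"
    using eps by simp
  moreover have "Jhat P (ctrl r (Suc k)) \<le> (1 - q) * Jhat P (ctrl r k)" if "k \<in> S" for k
    using successful_decrease[of k eps_g eps_R] eps that by (simp add: q_def S_def)
  moreover have "0 \<le> Jhat P (ctrl r k)" for k
    by (simp add: Jhat_eq)
  ultimately have geo: "finite S" "real (card S) \<le> 1 + \<bar>ln (Jhat P (ctrl r 0) / (eps_R\<^sup>2 / 2))\<bar> / q"
    using geometric_decrease_card_le[of q "eps_R\<^sup>2 / 2" "\<lambda>k. Jhat P (ctrl r k)" S] q Jhat_antimono counted
    by blast+
  have S_le: "real (card S) \<le> (1 + D) * (l * w)"
  proof (cases "Jhat P (ctrl r 0) > 0")
    case True
    have "ln (Jhat P (ctrl r 0) / (eps_R\<^sup>2 / 2)) = ln (2 * Jhat P (ctrl r 0)) + 2 * l"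
      using True eps by (simp add: ln_div ln_mult ln_realpow l_def)
    then have "\<bar>ln (Jhat P (ctrl r 0) / (eps_R\<^sup>2 / 2))\<bar> \<le> \<bar>ln (2 * Jhat P (ctrl r 0))\<bar> + 2 * l"
      using l by linarith
    also have "\<dots> \<le> (\<bar>ln (2 * Jhat P (ctrl r 0))\<bar> + 2) * l"
      using mult_left_mono[OF l, of "\<bar>ln (2 * Jhat P (ctrl r 0))\<bar>"] by (simp add: algebra_simps)
    finally have "\<bar>ln (Jhat P (ctrl r 0) / (eps_R\<^sup>2 / 2))\<bar> / q
        \<le> (\<bar>ln (2 * Jhat P (ctrl r 0))\<bar> + 2) * l / q"
      using q by (intro divide_right_mono) auto
    also have "\<dots> = D * (l * w)"
      using pos eta eps by (simp add: D_def q_def w_def field_simps)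
    finally show ?thesis
      using geo(2) lw by (simp add: algebra_simps)
  next
    case False
    \<comment> \<open>If the initial objective vanishes, so do all later ones, and nothing is counted.\<close>
    have "k \<notin> S" for k
    proof
      assume "k \<in> S"
      then have "0 < Jhat P (ctrl r k)"
        using counted[of k] eps by (smt (verit) divide_pos_pos zero_less_power)
      moreover have "Jhat P (ctrl r k) \<le> Jhat P (ctrl r 0)"
        using lift_Suc_antimono_le[of "\<lambda>k. Jhat P (ctrl r k)" 0 k] Jhat_antimono by simp
      ultimately show False
        using False by linarith
    qed
    then have "S = {}"
      by blast
    then show ?thesis
      using D lw by simp
  qed
  have near: "\<exists>j\<in>S. k \<le> j \<and> j \<le> k + K" if "k \<in> N" for k
    using success_within[of k eps_g eps_R K] that eps K unfolding N_def S_def by blast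
  have N: "finite N" "card N \<le> (K + 1) * card S"
    using card_le_if_followed_within[OF geo(1) near] by blast+
  show "finite N"
    by (rule N)
  show "card S \<le> card N"
    using N(1) by (rule card_mono) (auto simp: S_def N_def succ_iters_def)
  have "real (card N) \<le> (real K + 1) * real (card S)"
    using N(2) by (metis of_nat_1 of_nat_add of_nat_le_iff of_nat_mult)
  also have "\<dots> \<le> (real K + 1) * ((1 + D) * (l * w))"
    using S_le by (intro mult_left_mono) auto
  finally have "real (1 + card N) \<le> l * w + (real K + 1) * ((1 + D) * (l * w))"
    using lw by simp
  also have "\<dots> = C * l * w"
    by (simp add: C D_def algebra_simps)
  finally show "real (1 + card N) \<le> C * ln (1 / eps_R) * (1 / eps_g\<^sup>2)"
    by (simp add: l_def w_def)
qed

lemma num_constraint_solves: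
  "num_solves is_constraint_solve P eta r eps_g eps_R = 1 + card (counted_iters P r eps_g eps_R)"
  by (simp add: num_solves_def initial_solves_def iteration_solves_def)

text \<open>
An accepted step requires an adjoint solve; at counted iterations acceptance coincides with success.
  Finiteness matters because a sum over an infinite set is 0.
\<close>

lemma num_adjoint_solves:
  assumes eps: "eps_g > 0" "eps_R > 0" and fin: "finite (counted_iters P r eps_g eps_R)"
  shows "num_solves is_adjoint_solve P eta r eps_g eps_R = 1 + card (succ_iters P r eps_g eps_R)"
proof -
  let ?N = "counted_iters P r eps_g eps_R"
  have "length (filter is_adjoint_solve (iteration_solves P eta r k)) = (if successful r k then 1 else 0)"
    if "k \<in> ?N" for k
    using successful_iff[OF counted_imp(3)[OF that eps]] by (simp add: iteration_solves_def)
  then have "num_solves is_adjoint_solve P eta r eps_g eps_R = 1 + (\<Sum>k\<in>?N. if successful r k then 1 else 0)"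
    by (simp add: num_solves_def initial_solves_def cong: sum.cong)
  also have "(\<Sum>k\<in>?N. if successful r k then 1 else 0 :: nat) = card (succ_iters P r eps_g eps_R)"
    using fin by (simp add: succ_iters_def sum.If_cases Int_def)
  finally show ?thesis .
qed

end

theorem corollary3p1:
  fixes L M_H eta gamma0 gamma_min J0 :: real
  assumes "L > 0" and "M_H > 0" and "0 < eta" and "eta < 1"
    and "gamma0 > 0" and "0 < gamma_min" and "gamma_min \<le> gamma0"
  shows "\<exists>C>0. \<exists>eps_bar. 0 < eps_bar \<and> eps_bar < 1 \<and>
    (\<forall>(P :: ls_problem) (r :: method_data) (zeta :: real vec \<Rightarrow> real mat).
       ls_setting P \<longrightarrow>
       method_run P eta gamma0 gamma_min r \<longrightarrow>
       exact_steps P r \<longrightarrow>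
       Jhat P (ctrl r 0) = J0 \<longrightarrow>
       lipschitz_gradient P L \<longrightarrow>
       (\<forall>k. spectral_norm (hess r k) \<le> M_H) \<longrightarrow>
       (\<forall>k. positive_semidefinite_mat (dim_ctrl P) (hess r k)) \<longrightarrow>
       regular_constraint P \<longrightarrow>
       adjoint_evaluation P zeta \<longrightarrow>
       (\<forall>eps_g eps_R. 0 < eps_g \<longrightarrow> eps_g < 1 \<longrightarrow> 0 < eps_R \<longrightarrow> eps_R \<le> eps_bar \<longrightarrow>
          (let S = succ_iters P r eps_g eps_R;
               U = unsucc_iters P r eps_g eps_R;
               bound = C * ln (1 / eps_R) * (1 / eps_g\<^sup>2)
           in finite S \<and> finite U \<and>
              num_solves is_constraint_solve P eta r eps_g eps_R = 1 + card S + card U \<and>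
              real (1 + card S + card U) \<le> bound \<and>
              num_solves is_adjoint_solve P eta r eps_g eps_R = 1 + card S \<and>
              real (1 + card S) \<le> bound)))"
proof -
  \<comment> \<open>Enough doublings to lift \<open>gamma_min\<close> to \<open>L\<close>.\<close>
  obtain K where "L / gamma_min < 2 ^ K"
    using real_arch_pow[of 2 "L / gamma_min"] by auto
  then have K: "L \<le> 2 ^ K * gamma_min"
    using assms by (simp add: pos_divide_less_eq)
  \<comment> \<open>Each success accounts for at most \<open>K + 1\<close> counted iterations; the last factor bounds the number of
    successes relative to \<open>ln (1 / eps_R) / eps_g\<^sup>2\<close>.\<close>
  define C where "C = 1 + (real K + 1) *
    (1 + (\<bar>ln (2 * J0)\<bar> + 2) * (M_H + max gamma0 (2 * L)) / eta)"
  have "C > 0"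
    unfolding C_def using assms
    by (intro add_pos_nonneg mult_nonneg_nonneg add_nonneg_nonneg divide_nonneg_nonneg) auto
  moreover have "let S = succ_iters P r eps_g eps_R;
               U = unsucc_iters P r eps_g eps_R;
               bound = C * ln (1 / eps_R) * (1 / eps_g\<^sup>2)
           in finite S \<and> finite U \<and>
              num_solves is_constraint_solve P eta r eps_g eps_R = 1 + card S + card U \<and>
              real (1 + card S + card U) \<le> bound \<and>
              num_solves is_adjoint_solve P eta r eps_g eps_R = 1 + card S \<and>
              real (1 + card S) \<le> bound"
    if "ls_setting P" "method_run P eta gamma0 gamma_min r" "exact_steps P r"
      and J0: "Jhat P (ctrl r 0) = J0"
      and "lipschitz_gradient P L" "\<forall>k. spectral_norm (hess r k) \<le> M_H"
      "\<forall>k. positive_semidefinite_mat (dim_ctrl P) (hess r k)" "regular_constraint P"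
      and eps: "0 < eps_g" "eps_g < 1" "0 < eps_R" "eps_R \<le> exp (- 1)"
    for P r eps_g eps_R
  proof -
    interpret exact_regularized_run P r L M_H eta gamma0 gamma_min
      using assms that by unfold_locales auto
    let ?S = "succ_iters P r eps_g eps_R" and ?U = "unsucc_iters P r eps_g eps_R"
      and ?N = "counted_iters P r eps_g eps_R"
    note bounds = iteration_bounds[OF eps K, of C, unfolded J0 reg_max_def, OF C_def]
    have N: "?N = ?S \<union> ?U" "?S \<inter> ?U = {}"
      by (auto simp: succ_iters_def unsucc_iters_def)
    then have fin: "finite ?S" "finite ?U"
      using bounds(1) by auto
    then have card: "card ?N = card ?S + card ?U"
      unfolding N(1) using N(2) by (intro card_Un_disjoint)
    have "real (1 + card ?S) \<le> real (1 + card ?N)"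
      using bounds(2) by simp
    then have "real (1 + card ?S) \<le> C * ln (1 / eps_R) * (1 / eps_g\<^sup>2)"
      using bounds(3) by linarith
    then show ?thesis
      unfolding Let_def
      using fin card bounds(3) num_constraint_solves[of eps_g eps_R]
        num_adjoint_solves[OF eps(1,3) bounds(1)] by simp
  qed
  moreover have "0 < exp (- 1 :: real)" "exp (- 1 :: real) < 1"
    by simp_all
  ultimately show ?thesis
    by (intro exI[of _ C] conjI exI[of _ "exp (- 1)"]) blast+
qed

end
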